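(* Let $p$ be a prime and let $G=\mathbb{Z}/(p^{m_1})\oplus\mathbb{Z}/(p^{m_2})$ with positive integers $m_1\le m_2$; if $p=2$, assume $m_1>1$. Then the number of orbits of $A=\operatorname{Aut}(G)\times\mathbb{Z}_p^*$ on $\mathrm{H}^2(G;\mathbb{F}_p)$ is $4$ if $m_1=m_2$ and $6$ otherwise. Moreover, the orbit sizes are as follows. (i) If $m_1=m_2$: the orbits contained in $\mathrm{H}^2_{ab}(G;\mathbb{F}_p)$ have sizes $1,\ p^2-1$; the remaining orbits have sizes $p-1,\ (p-1)(p^2-1)$. (ii) If $m_1<m_2$: the orbits contained in $\mathrm{H}^2_{ab}(G;\mathbb{F}_p)$ have sizes $1,\ p-1,\ p^2-p$; the remaining orbits have sizes $p-1,\ (p-1)^2,\ (p-1)(p^2-p)$. In each case the remaining orbits, in the listed order, consist of the elements $[c]+[\omega]$ with $0\ne[\omega]\in\langle\operatorname{Im}\cup\rangle$ and $[c]$ in the corresponding listed orbit of $\mathrm{H}^2_{ab}(G;\mathbb{F}_p)$.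
   Context: $\mathbb{F}_p$ is a trivial $G$-module. $A$ acts on $\mathrm{H}^2(G;\mathbb{F}_p)$ by $(\sigma,\lambda)\cdot[c]=[\lambda c\sigma^{-1}]$, i.e. the class of $(x,y)\mapsto\lambda\,c(\sigma^{-1}(x),\sigma^{-1}(y))$. $\mathrm{H}^2_{ab}(G;\mathbb{F}_p)$ is the subspace of classes whose associated central extension of $G$ by $\mathbb{F}_p$ is an abelian group. $\operatorname{Im}\cup$ is the image of the cup product $\operatorname{Hom}(G,\mathbb{F}_p)\times\operatorname{Hom}(G,\mathbb{F}_p)\to \mathrm{H}^2(G;\mathbb{F}_p)$, where $[f\cup g]$ is the class of $(x,y)\mapsto f(x)g(y)$; one has $\mathrm{H}^2(G;\mathbb{F}_p)=\mathrm{H}^2_{ab}(G;\mathbb{F}_p)\oplus\langle\operatorname{Im}\cup\rangle$. *)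

theory Defs
  imports "HOL-Algebra.Group_Action" "HOL-Algebra.Elementary_Groups" "HOL-Number_Theory.Residues"
begin

section \<open>Second cohomology with trivial coefficients\<close>

text \<open>
  The group \<open>G\<close> is written multiplicatively, as usual in HOL-Algebra, and \<open>F\<close> is a ring whose
  additive group is the coefficient module, with trivial \<open>G\<close>-action. Cochains are
  inhomogeneous and not normalised; they are extensional, so that equality of cochains is
  equality on \<open>carrier G \<times> carrier G\<close>. The abelian groups of cochains, cocycles and cohomology
  classes are HOL-Algebra groups as well, so their addition is written as a multiplication.
\<close>

definition cochain_group2 ::
    "('a, 'm) monoid_scheme \<Rightarrow> ('f, 'n) ring_scheme \<Rightarrow> ('a \<times> 'a \<Rightarrow> 'f) monoid" where
  "cochain_group2 G F =
     \<lparr>carrier = carrier G \<times> carrier G \<rightarrow>\<^sub>E carrier F,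
      monoid.mult = \<lambda>c d. \<lambda>u\<in>carrier G \<times> carrier G. c u \<oplus>\<^bsub>F\<^esub> d u,
      one = \<lambda>u\<in>carrier G \<times> carrier G. \<zero>\<^bsub>F\<^esub>\<rparr>"

definition cocycles2 ::
    "('a, 'm) monoid_scheme \<Rightarrow> ('f, 'n) ring_scheme \<Rightarrow> ('a \<times> 'a \<Rightarrow> 'f) set" where
  "cocycles2 G F =
     {c \<in> carrier (cochain_group2 G F).
        \<forall>x\<in>carrier G. \<forall>y\<in>carrier G. \<forall>z\<in>carrier G.
          c (y, z) \<oplus>\<^bsub>F\<^esub> c (x, y \<otimes>\<^bsub>G\<^esub> z) = c (x \<otimes>\<^bsub>G\<^esub> y, z) \<oplus>\<^bsub>F\<^esub> c (x, y)}"

definition cocycle_group2 ::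
    "('a, 'm) monoid_scheme \<Rightarrow> ('f, 'n) ring_scheme \<Rightarrow> ('a \<times> 'a \<Rightarrow> 'f) monoid" where
  "cocycle_group2 G F = (cochain_group2 G F)\<lparr>carrier := cocycles2 G F\<rparr>"

definition coboundary2 ::
    "('a, 'm) monoid_scheme \<Rightarrow> ('f, 'n) ring_scheme \<Rightarrow> ('a \<Rightarrow> 'f) \<Rightarrow> 'a \<times> 'a \<Rightarrow> 'f" where
  "coboundary2 G F h =
     (\<lambda>(x, y)\<in>carrier G \<times> carrier G. h x \<oplus>\<^bsub>F\<^esub> h y \<ominus>\<^bsub>F\<^esub> h (x \<otimes>\<^bsub>G\<^esub> y))"

definition coboundaries2 ::
    "('a, 'm) monoid_scheme \<Rightarrow> ('f, 'n) ring_scheme \<Rightarrow> ('a \<times> 'a \<Rightarrow> 'f) set" where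
  "coboundaries2 G F = coboundary2 G F ` (carrier G \<rightarrow> carrier F)"

definition H2 ::
    "('a, 'm) monoid_scheme \<Rightarrow> ('f, 'n) ring_scheme \<Rightarrow> ('a \<times> 'a \<Rightarrow> 'f) set monoid" where
  "H2 G F = cocycle_group2 G F Mod coboundaries2 G F"

definition H2_class ::
    "('a, 'm) monoid_scheme \<Rightarrow> ('f, 'n) ring_scheme \<Rightarrow> ('a \<times> 'a \<Rightarrow> 'f) \<Rightarrow> ('a \<times> 'a \<Rightarrow> 'f) set" where
  "H2_class G F c = coboundaries2 G F #>\<^bsub>cocycle_group2 G F\<^esub> c"


section \<open>Scalar multiplication and the action of automorphisms and units\<close>

definition cochain_smult ::
    "('a, 'm) monoid_scheme \<Rightarrow> ('f, 'n) ring_scheme \<Rightarrow> 'f \<Rightarrow> ('a \<times> 'a \<Rightarrow> 'f) \<Rightarrow> 'a \<times> 'a \<Rightarrow> 'f" where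
  "cochain_smult G F k c = (\<lambda>u\<in>carrier G \<times> carrier G. k \<otimes>\<^bsub>F\<^esub> c u)"

definition cochain_act ::
    "('a, 'm) monoid_scheme \<Rightarrow> ('f, 'n) ring_scheme \<Rightarrow> ('a \<Rightarrow> 'a) \<times> 'f
      \<Rightarrow> ('a \<times> 'a \<Rightarrow> 'f) \<Rightarrow> 'a \<times> 'a \<Rightarrow> 'f" where
  "cochain_act G F = (\<lambda>(\<sigma>, k) c. \<lambda>(x, y)\<in>carrier G \<times> carrier G.
     k \<otimes>\<^bsub>F\<^esub> c (inv_into (carrier G) \<sigma> x, inv_into (carrier G) \<sigma> y))"

text \<open>
  A map on cocycles that respects cohomology is applied to a class by taking the union of the
  classes of the images of all representatives. All these classes coincide, see
  \<open>H2_smult_class\<close> and \<open>H2_act_class\<close> below.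
\<close>

definition H2_smult ::
    "('a, 'm) monoid_scheme \<Rightarrow> ('f, 'n) ring_scheme \<Rightarrow> 'f
      \<Rightarrow> ('a \<times> 'a \<Rightarrow> 'f) set \<Rightarrow> ('a \<times> 'a \<Rightarrow> 'f) set" where
  "H2_smult G F k = (\<lambda>\<xi>\<in>carrier (H2 G F). \<Union>c\<in>\<xi>. H2_class G F (cochain_smult G F k c))"

definition H2_act ::
    "('a, 'm) monoid_scheme \<Rightarrow> ('f, 'n) ring_scheme \<Rightarrow> ('a \<Rightarrow> 'a) \<times> 'f
      \<Rightarrow> ('a \<times> 'a \<Rightarrow> 'f) set \<Rightarrow> ('a \<times> 'a \<Rightarrow> 'f) set" where
  "H2_act G F a = (\<lambda>\<xi>\<in>carrier (H2 G F). \<Union>c\<in>\<xi>. H2_class G F (cochain_act G F a c))"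

definition aut_units ::
    "('a, 'm) monoid_scheme \<Rightarrow> ('f, 'n) ring_scheme \<Rightarrow> (('a \<Rightarrow> 'a) \<times> 'f) monoid" where
  "aut_units G F = AutoGroup G \<times>\<times> units_of F"


section \<open>Abelian extensions and cup products\<close>

text \<open>
  The unit of the extension is the correct one also for cocycles that are not normalised.
\<close>

definition central_extension ::
    "('a, 'm) monoid_scheme \<Rightarrow> ('f, 'n) ring_scheme \<Rightarrow> ('a \<times> 'a \<Rightarrow> 'f) \<Rightarrow> ('f \<times> 'a) monoid" where
  "central_extension G F c =
     \<lparr>carrier = carrier F \<times> carrier G,
      monoid.mult = \<lambda>(a, x) (b, y). (a \<oplus>\<^bsub>F\<^esub> b \<oplus>\<^bsub>F\<^esub> c (x, y), x \<otimes>\<^bsub>G\<^esub> y),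
      one = (\<ominus>\<^bsub>F\<^esub> c (\<one>\<^bsub>G\<^esub>, \<one>\<^bsub>G\<^esub>), \<one>\<^bsub>G\<^esub>)\<rparr>"

definition H2_ab ::
    "('a, 'm) monoid_scheme \<Rightarrow> ('f, 'n) ring_scheme \<Rightarrow> ('a \<times> 'a \<Rightarrow> 'f) set set" where
  "H2_ab G F = {H2_class G F c | c. c \<in> cocycles2 G F \<and> comm_group (central_extension G F c)}"

definition cup ::
    "('a, 'm) monoid_scheme \<Rightarrow> ('f, 'n) ring_scheme \<Rightarrow> ('a \<Rightarrow> 'f) \<Rightarrow> ('a \<Rightarrow> 'f) \<Rightarrow> 'a \<times> 'a \<Rightarrow> 'f" where
  "cup G F f g = (\<lambda>(x, y)\<in>carrier G \<times> carrier G. f x \<otimes>\<^bsub>F\<^esub> g y)"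

definition Im_cup ::
    "('a, 'm) monoid_scheme \<Rightarrow> ('f, 'n) ring_scheme \<Rightarrow> ('a \<times> 'a \<Rightarrow> 'f) set set" where
  "Im_cup G F =
     {H2_class G F (cup G F f g) | f g. f \<in> hom G (add_monoid F) \<and> g \<in> hom G (add_monoid F)}"

definition H2_span ::
    "('a, 'm) monoid_scheme \<Rightarrow> ('f, 'n) ring_scheme
      \<Rightarrow> ('a \<times> 'a \<Rightarrow> 'f) set set \<Rightarrow> ('a \<times> 'a \<Rightarrow> 'f) set set" where
  "H2_span G F S =
     \<Inter>{V. subgroup V (H2 G F) \<and> (\<forall>k\<in>carrier F. \<forall>\<xi>\<in>V. H2_smult G F k \<xi> \<in> V) \<and> S \<subseteq> V}"

definition cup_translates ::
    "('a, 'm) monoid_scheme \<Rightarrow> ('f, 'n) ring_scheme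
      \<Rightarrow> ('a \<times> 'a \<Rightarrow> 'f) set set \<Rightarrow> ('a \<times> 'a \<Rightarrow> 'f) set set" where
  "cup_translates G F \<Omega> =
     {\<xi> \<otimes>\<^bsub>H2 G F\<^esub> \<omega> | \<xi> \<omega>. \<xi> \<in> \<Omega> \<and> \<omega> \<in> H2_span G F (Im_cup G F) \<and> \<omega> \<noteq> \<one>\<^bsub>H2 G F\<^esub>}"


section \<open>Well-definedness\<close>

locale trivial_coeff = G: group G + F: ring F for G (structure) and F (structure)
begin

abbreviation "Z \<equiv> cocycle_group2 G F"
abbreviation "B \<equiv> coboundaries2 G F"

lemma cochain_group: "comm_group (cochain_group2 G F)"
proof (rule comm_groupI)
  fix c assume c: "c \<in> carrier (cochain_group2 G F)"
  show "\<exists>d\<in>carrier (cochain_group2 G F). d \<otimes>\<^bsub>cochain_group2 G F\<^esub> c = \<one>\<^bsub>cochain_group2 G F\<^esub>"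
    by (rule bexI[of _ "\<lambda>u\<in>carrier G \<times> carrier G. \<ominus>\<^bsub>F\<^esub> c u"])
      (use c in \<open>auto simp: cochain_group2_def PiE_iff F.l_neg intro!: restrict_ext\<close>)
next
  fix c assume c: "c \<in> carrier (cochain_group2 G F)"
  show "\<one>\<^bsub>cochain_group2 G F\<^esub> \<otimes>\<^bsub>cochain_group2 G F\<^esub> c = c"
    using c by (auto simp: cochain_group2_def PiE_iff extensional_def fun_eq_iff)
qed (auto simp: cochain_group2_def PiE_iff F.a_ac intro!: restrict_ext)

lemma cocycleD:
  assumes "c \<in> cocycles2 G F" "x \<in> carrier G" "y \<in> carrier G"
  shows "c (x, y) \<in> carrier F"
  using assms by (auto simp: cocycles2_def cochain_group2_def)

lemma subgroup_cocycles: "subgroup (cocycles2 G F) (cochain_group2 G F)"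
proof -
  interpret C: comm_group "cochain_group2 G F" by (rule cochain_group)
  have inv: "inv\<^bsub>cochain_group2 G F\<^esub> c = (\<lambda>u\<in>carrier G \<times> carrier G. \<ominus>\<^bsub>F\<^esub> c u)"
    if "c \<in> carrier (cochain_group2 G F)" for c
    by (rule C.inv_equality)
      (use that in \<open>auto simp: cochain_group2_def PiE_iff F.l_neg intro!: restrict_ext\<close>)
  show ?thesis
  proof (rule C.subgroupI)
    show "cocycles2 G F \<subseteq> carrier (cochain_group2 G F)" by (auto simp: cocycles2_def)
    have "\<one>\<^bsub>cochain_group2 G F\<^esub> \<in> cocycles2 G F"
      by (auto simp: cocycles2_def cochain_group2_def)
    then show "cocycles2 G F \<noteq> {}" by blast
  next
    fix c assume c: "c \<in> cocycles2 G F"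
    then have c': "c \<in> carrier (cochain_group2 G F)" by (auto simp: cocycles2_def)
    show "inv\<^bsub>cochain_group2 G F\<^esub> c \<in> cocycles2 G F"
      unfolding inv[OF c'] using c
      by (auto simp: cocycles2_def cochain_group2_def PiE_iff F.minus_add[symmetric])
  next
    fix c d assume cd: "c \<in> cocycles2 G F" "d \<in> cocycles2 G F"
    have "c \<otimes>\<^bsub>cochain_group2 G F\<^esub> d \<in> carrier (cochain_group2 G F)"
      using cd by (auto simp: cocycles2_def)
    moreover have "c (y, z) \<oplus>\<^bsub>F\<^esub> d (y, z) \<oplus>\<^bsub>F\<^esub> (c (x, y \<otimes> z) \<oplus>\<^bsub>F\<^esub> d (x, y \<otimes> z))
        = c (x \<otimes> y, z) \<oplus>\<^bsub>F\<^esub> d (x \<otimes> y, z) \<oplus>\<^bsub>F\<^esub> (c (x, y) \<oplus>\<^bsub>F\<^esub> d (x, y))"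
      if xyz: "x \<in> carrier G" "y \<in> carrier G" "z \<in> carrier G" for x y z
    proof -
      note [simp] = cocycleD[OF cd(1)] cocycleD[OF cd(2)] xyz
      have "c (y, z) \<oplus>\<^bsub>F\<^esub> d (y, z) \<oplus>\<^bsub>F\<^esub> (c (x, y \<otimes> z) \<oplus>\<^bsub>F\<^esub> d (x, y \<otimes> z))
          = (c (y, z) \<oplus>\<^bsub>F\<^esub> c (x, y \<otimes> z)) \<oplus>\<^bsub>F\<^esub> (d (y, z) \<oplus>\<^bsub>F\<^esub> d (x, y \<otimes> z))"
        by (simp add: F.a_ac)
      also have "\<dots> = (c (x \<otimes> y, z) \<oplus>\<^bsub>F\<^esub> c (x, y)) \<oplus>\<^bsub>F\<^esub> (d (x \<otimes> y, z) \<oplus>\<^bsub>F\<^esub> d (x, y))"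
        using cd by (simp add: cocycles2_def)
      also have "\<dots> = c (x \<otimes> y, z) \<oplus>\<^bsub>F\<^esub> d (x \<otimes> y, z) \<oplus>\<^bsub>F\<^esub> (c (x, y) \<oplus>\<^bsub>F\<^esub> d (x, y))"
        by (simp add: F.a_ac)
      finally show ?thesis .
    qed
    ultimately show "c \<otimes>\<^bsub>cochain_group2 G F\<^esub> d \<in> cocycles2 G F"
      by (auto simp: cocycles2_def cochain_group2_def)
  qed
qed

lemma Z_comm_group: "comm_group Z"
proof -
  interpret C: comm_group "cochain_group2 G F" by (rule cochain_group)
  have "group Z"
    unfolding cocycle_group2_def by (rule C.subgroup_imp_group[OF subgroup_cocycles])
  then show ?thesis
    by (rule group.group_comm_groupI)
      (auto simp: cocycle_group2_def cocycles2_def intro: C.m_comm)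
qed

lemma Z_simps [simp]:
  "carrier Z = cocycles2 G F"
  "c \<otimes>\<^bsub>Z\<^esub> d = (\<lambda>u\<in>carrier G \<times> carrier G. c u \<oplus>\<^bsub>F\<^esub> d u)"
  "\<one>\<^bsub>Z\<^esub> = (\<lambda>u\<in>carrier G \<times> carrier G. \<zero>\<^bsub>F\<^esub>)"
  by (simp_all add: cocycle_group2_def cochain_group2_def)

lemma coboundary_cocycle:
  assumes h: "h \<in> carrier G \<rightarrow> carrier F"
  shows "coboundary2 G F h \<in> cocycles2 G F"
proof -
  have [simp]: "h x \<in> carrier F" if "x \<in> carrier G" for x using h that by auto
  have "h y \<oplus>\<^bsub>F\<^esub> h z \<ominus>\<^bsub>F\<^esub> h (y \<otimes> z) \<oplus>\<^bsub>F\<^esub> (h x \<oplus>\<^bsub>F\<^esub> h (y \<otimes> z) \<ominus>\<^bsub>F\<^esub> h (x \<otimes> (y \<otimes> z)))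
     = h (x \<otimes> y) \<oplus>\<^bsub>F\<^esub> h z \<ominus>\<^bsub>F\<^esub> h (x \<otimes> y \<otimes> z) \<oplus>\<^bsub>F\<^esub> (h x \<oplus>\<^bsub>F\<^esub> h y \<ominus>\<^bsub>F\<^esub> h (x \<otimes> y))"
    if xyz: "x \<in> carrier G" "y \<in> carrier G" "z \<in> carrier G" for x y z
    using xyz by (simp add: G.m_assoc F.minus_eq F.a_ac F.r_neg1 F.r_neg2)
  then show ?thesis
    by (auto simp: cocycles2_def cochain_group2_def coboundary2_def)
qed

lemma subgroup_coboundaries: "subgroup B Z"
proof -
  interpret Z: comm_group Z by (rule Z_comm_group)
  have add: "coboundary2 G F h \<otimes>\<^bsub>Z\<^esub> coboundary2 G F k = coboundary2 G F (\<lambda>x. h x \<oplus>\<^bsub>F\<^esub> k x)"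
    if "h \<in> carrier G \<rightarrow> carrier F" "k \<in> carrier G \<rightarrow> carrier F" for h k
  proof -
    have [simp]: "h x \<in> carrier F" "k x \<in> carrier F" if "x \<in> carrier G" for x
      using \<open>h \<in> _\<close> \<open>k \<in> _\<close> that by auto
    show ?thesis
      by (rule ext) (auto simp: coboundary2_def F.minus_eq F.minus_add F.a_ac)
  qed
  have zero: "coboundary2 G F (\<lambda>_. \<zero>\<^bsub>F\<^esub>) = \<one>\<^bsub>Z\<^esub>"
    by (auto simp: coboundary2_def F.minus_eq)
  have zero': "coboundary2 G F (\<lambda>_. \<zero>\<^bsub>F\<^esub>) \<in> B" by (auto simp: coboundaries2_def)
  show ?thesis
  proof (rule Z.subgroupI)
    show "B \<subseteq> carrier Z" by (auto simp: coboundaries2_def coboundary_cocycle)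
    show "B \<noteq> {}" using zero' by blast
  next
    fix c assume "c \<in> B"
    then obtain h where h: "h \<in> carrier G \<rightarrow> carrier F" and c: "c = coboundary2 G F h"
      by (auto simp: coboundaries2_def)
    have h': "(\<lambda>x. \<ominus>\<^bsub>F\<^esub> h x) \<in> carrier G \<rightarrow> carrier F" using h by auto
    have "coboundary2 G F (\<lambda>x. \<ominus>\<^bsub>F\<^esub> h x) \<otimes>\<^bsub>Z\<^esub> c = coboundary2 G F (\<lambda>_. \<zero>\<^bsub>F\<^esub>)"
      unfolding c add[OF h' h] using h
      by (auto simp: coboundary2_def F.l_neg Pi_iff intro!: restrict_ext)
    then have "inv\<^bsub>Z\<^esub> c = coboundary2 G F (\<lambda>x. \<ominus>\<^bsub>F\<^esub> h x)"
      unfolding zero using h h' c by (intro Z.inv_equality) (auto intro: coboundary_cocycle)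
    then show "inv\<^bsub>Z\<^esub> c \<in> B" using h' by (auto simp: coboundaries2_def)
  next
    fix c d assume "c \<in> B" "d \<in> B"
    then obtain h k where hk: "h \<in> carrier G \<rightarrow> carrier F" "k \<in> carrier G \<rightarrow> carrier F"
      and cd: "c = coboundary2 G F h" "d = coboundary2 G F k"
      by (auto simp: coboundaries2_def)
    have "(\<lambda>x. h x \<oplus>\<^bsub>F\<^esub> k x) \<in> carrier G \<rightarrow> carrier F" using hk by auto
    then show "c \<otimes>\<^bsub>Z\<^esub> d \<in> B"
      unfolding cd add[OF hk] by (auto simp: coboundaries2_def)
  qed
qed

lemma H2_carrier: "carrier (H2 G F) = H2_class G F ` cocycles2 G F"
  by (auto simp: H2_def FactGroup_def RCOSETS_def H2_class_def)

lemma H2_comm_group: "comm_group (H2 G F)"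
  unfolding H2_def
  using comm_group.abelian_FactGroup[OF Z_comm_group subgroup_coboundaries] .

lemma H2_class_eqI:
  assumes "c \<in> cocycles2 G F" "d \<in> H2_class G F c"
  shows "H2_class G F d = H2_class G F c"
proof -
  interpret Z: comm_group Z by (rule Z_comm_group)
  show ?thesis
    using Z.repr_independence[OF _ _ subgroup_coboundaries] assms
    by (simp add: H2_class_def)
qed

lemma mem_H2_class:
  assumes "c \<in> cocycles2 G F"
  shows "c \<in> H2_class G F c"
proof -
  interpret Z: comm_group Z by (rule Z_comm_group)
  show ?thesis
    using Z.rcos_self[OF _ subgroup_coboundaries] assms by (simp add: H2_class_def)
qed

lemma H2_class_mult:
  assumes "c \<in> cocycles2 G F" "d \<in> cocycles2 G F"
  shows "H2_class G F c \<otimes>\<^bsub>H2 G F\<^esub> H2_class G F d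
       = H2_class G F (\<lambda>u\<in>carrier G \<times> carrier G. c u \<oplus>\<^bsub>F\<^esub> d u)"
proof -
  interpret Z: comm_group Z by (rule Z_comm_group)
  interpret N: normal B Z by (rule Z.subgroup_imp_normal[OF subgroup_coboundaries])
  show ?thesis
    using N.rcos_sum[of c d] assms by (simp add: H2_def FactGroup_def H2_class_def)
qed

lemma H2_one: "\<one>\<^bsub>H2 G F\<^esub> = B"
  by (simp add: H2_def FactGroup_def)

text \<open>A twist \<open>k \<cdot> (\<tau>\<^sup>* c)\<close> by an endomorphism \<open>\<tau>\<close> and a scalar \<open>k\<close> respects cohomology.\<close>

lemma twist_cocycle:
  assumes \<tau>: "\<tau> \<in> hom G G" and k: "k \<in> carrier F" and c: "c \<in> cocycles2 G F"
  shows "(\<lambda>(x, y)\<in>carrier G \<times> carrier G. k \<otimes>\<^bsub>F\<^esub> c (\<tau> x, \<tau> y)) \<in> cocycles2 G F"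
proof -
  have [simp]: "\<tau> x \<in> carrier G" if "x \<in> carrier G" for x
    using \<tau> that by (auto simp: hom_def)
  have [simp]: "\<tau> (x \<otimes> y) = \<tau> x \<otimes> \<tau> y" if "x \<in> carrier G" "y \<in> carrier G" for x y
    using \<tau> that by (auto simp: hom_def)
  note [simp] = cocycleD[OF c] k
  have eq: "c (y, z) \<oplus>\<^bsub>F\<^esub> c (x, y \<otimes> z) = c (x \<otimes> y, z) \<oplus>\<^bsub>F\<^esub> c (x, y)"
    if "x \<in> carrier G" "y \<in> carrier G" "z \<in> carrier G" for x y z
    using c that by (auto simp: cocycles2_def)
  show ?thesis
    by (auto simp: cocycles2_def cochain_group2_def F.r_distr[symmetric] eq)
qed

lemma twist_class:
  assumes \<tau>: "\<tau> \<in> hom G G" and k: "k \<in> carrier F" and c: "c \<in> cocycles2 G F"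
    and d: "d \<in> H2_class G F c"
  defines "t \<equiv> \<lambda>c. \<lambda>(x, y)\<in>carrier G \<times> carrier G. k \<otimes>\<^bsub>F\<^esub> c (\<tau> x, \<tau> y)"
  shows "H2_class G F (t d) = H2_class G F (t c)"
proof -
  have \<tau>c [simp]: "\<tau> x \<in> carrier G" if "x \<in> carrier G" for x
    using \<tau> that by (auto simp: hom_def)
  have \<tau>m [simp]: "\<tau> (x \<otimes> y) = \<tau> x \<otimes> \<tau> y" if "x \<in> carrier G" "y \<in> carrier G" for x y
    using \<tau> that by (auto simp: hom_def)
  note [simp] = cocycleD[OF c] k
  obtain h where h: "h \<in> carrier G \<rightarrow> carrier F" and d: "d = coboundary2 G F h \<otimes>\<^bsub>Z\<^esub> c"
    using d by (auto simp: H2_class_def r_coset_def coboundaries2_def)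
  have [simp]: "h x \<in> carrier F" if "x \<in> carrier G" for x using h that by auto
  have h': "(\<lambda>x. k \<otimes>\<^bsub>F\<^esub> h (\<tau> x)) \<in> carrier G \<rightarrow> carrier F" by auto
  have "t d = coboundary2 G F (\<lambda>x. k \<otimes>\<^bsub>F\<^esub> h (\<tau> x)) \<otimes>\<^bsub>Z\<^esub> t c"
    by (rule ext)
      (auto simp: t_def d coboundary2_def F.minus_eq F.r_distr F.r_minus)
  then have "t d \<in> H2_class G F (t c)"
    using h' by (auto simp: H2_class_def r_coset_def coboundaries2_def)
  moreover have "t c \<in> cocycles2 G F"
    unfolding t_def by (rule twist_cocycle[OF \<tau> k c])
  ultimately show ?thesis by (intro H2_class_eqI)
qed

lemma H2_smult_class:
  assumes k: "k \<in> carrier F" and c: "c \<in> cocycles2 G F"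
  shows "H2_smult G F k (H2_class G F c) = H2_class G F (cochain_smult G F k c)"
proof -
  have eq: "cochain_smult G F k c = (\<lambda>(x, y)\<in>carrier G \<times> carrier G. k \<otimes>\<^bsub>F\<^esub> c (id x, id y))" for c
    by (auto simp: cochain_smult_def)
  have "H2_class G F (cochain_smult G F k d) = H2_class G F (cochain_smult G F k c)"
    if "d \<in> H2_class G F c" for d
    unfolding eq by (rule twist_class[OF _ k c that]) (auto simp: hom_def)
  then have "(\<Union>d\<in>H2_class G F c. H2_class G F (cochain_smult G F k d))
      = H2_class G F (cochain_smult G F k c)"
    using mem_H2_class[OF c] by blast
  then show ?thesis
    using c by (simp add: H2_smult_def H2_carrier)
qed

lemma aut_unitsD:
  assumes "(\<sigma>, k) \<in> carrier (aut_units G F)"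
  shows "\<sigma> \<in> auto G" "k \<in> Units F" "k \<in> carrier F"
    "restrict (inv_into (carrier G) \<sigma>) (carrier G) \<in> hom G G"
  using assms G.restrict_inv_into_hom[of \<sigma>]
  by (auto simp: aut_units_def AutoGroup_def auto_def units_of_def DirProd_def)

lemma cochain_act_eq:
  "cochain_act G F (\<sigma>, k) c = (\<lambda>(x, y)\<in>carrier G \<times> carrier G.
     k \<otimes>\<^bsub>F\<^esub> c (restrict (inv_into (carrier G) \<sigma>) (carrier G) x,
                restrict (inv_into (carrier G) \<sigma>) (carrier G) y))"
  by (auto simp: cochain_act_def)

lemma cochain_act_cocycle:
  assumes "(\<sigma>, k) \<in> carrier (aut_units G F)" "c \<in> cocycles2 G F"
  shows "cochain_act G F (\<sigma>, k) c \<in> cocycles2 G F"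
  unfolding cochain_act_eq using aut_unitsD[OF assms(1)] assms(2) by (intro twist_cocycle)

lemma H2_act_class:
  assumes a: "(\<sigma>, k) \<in> carrier (aut_units G F)" and c: "c \<in> cocycles2 G F"
  shows "H2_act G F (\<sigma>, k) (H2_class G F c) = H2_class G F (cochain_act G F (\<sigma>, k) c)"
proof -
  have "H2_class G F (cochain_act G F (\<sigma>, k) d) = H2_class G F (cochain_act G F (\<sigma>, k) c)"
    if "d \<in> H2_class G F c" for d
    unfolding cochain_act_eq
    by (rule twist_class[OF aut_unitsD(4)[OF a] aut_unitsD(3)[OF a] c that])
  then have "(\<Union>d\<in>H2_class G F c. H2_class G F (cochain_act G F (\<sigma>, k) d))
      = H2_class G F (cochain_act G F (\<sigma>, k) c)"
    using mem_H2_class[OF c] by blast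
  then show ?thesis
    using c by (simp add: H2_act_def H2_carrier)
qed

end

end

theory Submission
  imports Defs
begin

text \<open>
  A cocycle \<open>c\<close> has the three coordinates \<open>a\<^sub>i = \<Sum>k<p^m\<^sub>i. c(k e\<^sub>i, e\<^sub>i)\<close> (the \<open>p^m\<^sub>i\<close>-th power of a lift of
  the generator \<open>e\<^sub>i\<close> to the extension \<open>E\<close>) and \<open>b = c(e\<^sub>1, e\<^sub>2) - c(e\<^sub>2, e\<^sub>1)\<close> (the commutator of the lifts).
  If they vanish, the lifts define a splitting of \<open>E\<close>, and carry cocycles together with a cup product
  realise all values, so the coordinates identify \<open>H\<^sup>2\<close> with \<open>F\<^sub>p\<^sup>3\<close>. The abelian classes are those with
  \<open>b = 0\<close> and the cup products span \<open>a = 0\<close>; this is where \<open>p \<noteq> 2\<close> or \<open>m\<^sub>1 > 1\<close> enters, through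
  \<open>p\<close> dividing \<open>0 + 1 + \<dots> + (p^m\<^sub>i - 1)\<close>. An automorphism acts on the socle of \<open>G\<close> by a matrix
  \<open>M \<in> GL\<^sub>2(F\<^sub>p)\<close>, arbitrary if \<open>m\<^sub>1 = m\<^sub>2\<close> and triangular if \<open>m\<^sub>1 < m\<^sub>2\<close>, and a pair \<open>(\<sigma>, k)\<close> acts on
  coordinates by \<open>a \<mapsto> k M a\<close>, \<open>b \<mapsto> k det(M) b\<close>, with \<open>M\<close> the matrix of the inverse of \<open>\<sigma>\<close>. The
  orbits of this linear action are read off directly.
\<close>

section \<open>The extension of a cocycle\<close>

context trivial_coeff
begin

lemma cocycle_eq:
  assumes "c \<in> cocycles2 G F" "x \<in> carrier G" "y \<in> carrier G" "z \<in> carrier G"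
  shows "c (y, z) \<oplus>\<^bsub>F\<^esub> c (x, y \<otimes> z) = c (x \<otimes> y, z) \<oplus>\<^bsub>F\<^esub> c (x, y)"
  using assms by (auto simp: cocycles2_def)

text \<open>Cancellation in the cocycle identity at \<open>(1, 1, x)\<close>. It makes
  \<open>(- c(1, 1), 1)\<close> a left unit of the extension although \<open>c\<close> need not be
  normalised.\<close>

lemma cocycle_one_left:
  assumes c: "c \<in> cocycles2 G F" and x: "x \<in> carrier G"
  shows "c (\<one>, x) = c (\<one>, \<one>)"
proof -
  note [simp] = cocycleD[OF c] x
  have "c (\<one>, x) \<oplus>\<^bsub>F\<^esub> c (\<one>, x) = c (\<one>, x) \<oplus>\<^bsub>F\<^esub> c (\<one>, \<one>)"
    using cocycle_eq[OF c, of \<one> \<one> x] by simp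
  then show ?thesis by simp
qed

text \<open>Associativity is the cocycle identity; a left unit and left inverses complete the group
  axioms.\<close>

lemma group_central_extension:
  assumes c: "c \<in> cocycles2 G F"
  shows "group (central_extension G F c)"
proof (rule groupI)
  let ?E = "central_extension G F c"
  note [simp] = cocycleD[OF c]
  fix X assume "X \<in> carrier ?E"
  then obtain a x where [simp]: "X = (a, x)" "a \<in> carrier F" "x \<in> carrier G"
    by (auto simp: central_extension_def)
  show "\<one>\<^bsub>?E\<^esub> \<otimes>\<^bsub>?E\<^esub> X = X"
    by (simp add: central_extension_def cocycle_one_left[OF c, of x] F.a_ac F.r_neg F.r_neg1 F.r_neg2)
  have [simp]: "u \<oplus>\<^bsub>F\<^esub> (v \<oplus>\<^bsub>F\<^esub> \<ominus>\<^bsub>F\<^esub> u) = v" if "u \<in> carrier F" "v \<in> carrier F" for u v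
    using that F.r_neg2[of u v] F.a_comm[of v "\<ominus>\<^bsub>F\<^esub> u"] by simp
  show "\<exists>Y\<in>carrier ?E. Y \<otimes>\<^bsub>?E\<^esub> X = \<one>\<^bsub>?E\<^esub>"
    \<comment> \<open>The solution of \<open>Y X = 1\<close>; the summand \<open>- c(1, 1)\<close>
      is the first component of the unit.\<close>
    by (rule bexI[of _ "(\<ominus>\<^bsub>F\<^esub> c (\<one>, \<one>) \<ominus>\<^bsub>F\<^esub> a \<ominus>\<^bsub>F\<^esub> c (inv x, x), inv x)"])
      (simp_all add: central_extension_def F.minus_eq F.a_ac F.r_neg1 F.r_neg2 F.l_neg F.r_neg)
next
  let ?E = "central_extension G F c"
  note [simp] = cocycleD[OF c]
  fix X Y Z assume "X \<in> carrier ?E" "Y \<in> carrier ?E" "Z \<in> carrier ?E"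
  then obtain a x b y d z where
    XYZ: "X = (a, x)" "Y = (b, y)" "Z = (d, z)"
    and [simp]: "a \<in> carrier F" "x \<in> carrier G" "b \<in> carrier F" "y \<in> carrier G"
      "d \<in> carrier F" "z \<in> carrier G"
    by (auto simp: central_extension_def)
  have "a \<oplus>\<^bsub>F\<^esub> b \<oplus>\<^bsub>F\<^esub> c (x, y) \<oplus>\<^bsub>F\<^esub> d \<oplus>\<^bsub>F\<^esub> c (x \<otimes> y, z)
      = a \<oplus>\<^bsub>F\<^esub> b \<oplus>\<^bsub>F\<^esub> d \<oplus>\<^bsub>F\<^esub> (c (x \<otimes> y, z) \<oplus>\<^bsub>F\<^esub> c (x, y))"
    by (simp add: F.a_ac)
  also have "\<dots> = a \<oplus>\<^bsub>F\<^esub> (b \<oplus>\<^bsub>F\<^esub> d \<oplus>\<^bsub>F\<^esub> c (y, z)) \<oplus>\<^bsub>F\<^esub> c (x, y \<otimes> z)"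
    by (subst cocycle_eq[OF c, symmetric]) (simp_all add: F.a_ac)
  finally show "X \<otimes>\<^bsub>?E\<^esub> Y \<otimes>\<^bsub>?E\<^esub> Z = X \<otimes>\<^bsub>?E\<^esub> (Y \<otimes>\<^bsub>?E\<^esub> Z)"
    by (simp add: central_extension_def XYZ G.m_assoc)
qed (auto simp: central_extension_def cocycleD[OF c])

text \<open>The product of \<open>(0, x)\<close> and \<open>(0, y)\<close> has first component
  \<open>c (x, y)\<close>, so commutativity of the extension amounts to symmetry of
  \<open>c\<close>.\<close>

lemma comm_group_central_extension_iff:
  assumes c: "c \<in> cocycles2 G F" and G: "comm_group G"
  shows "comm_group (central_extension G F c)
    \<longleftrightarrow> (\<forall>x\<in>carrier G. \<forall>y\<in>carrier G. c (x, y) = c (y, x))"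
proof
  let ?E = "central_extension G F c"
  note [simp] = cocycleD[OF c]
  assume E: "comm_group ?E"
  show "\<forall>x\<in>carrier G. \<forall>y\<in>carrier G. c (x, y) = c (y, x)"
  proof (intro ballI)
    fix x y assume [simp]: "x \<in> carrier G" "y \<in> carrier G"
    have "(\<zero>\<^bsub>F\<^esub>, x) \<otimes>\<^bsub>?E\<^esub> (\<zero>\<^bsub>F\<^esub>, y) = (\<zero>\<^bsub>F\<^esub>, y) \<otimes>\<^bsub>?E\<^esub> (\<zero>\<^bsub>F\<^esub>, x)"
      using comm_groupE(4)[OF E, of "(\<zero>\<^bsub>F\<^esub>, x)" "(\<zero>\<^bsub>F\<^esub>, y)"]
      by (simp add: central_extension_def)
    then show "c (x, y) = c (y, x)" by (simp add: central_extension_def)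
  qed
next
  assume "\<forall>x\<in>carrier G. \<forall>y\<in>carrier G. c (x, y) = c (y, x)"
  then show "comm_group (central_extension G F c)"
    using comm_groupE(4)[OF G] cocycleD[OF c]
    by (intro group.group_comm_groupI[OF group_central_extension[OF c]])
      (auto simp: central_extension_def F.a_ac)
qed

end

lemma (in monoid) pow_mod:
  assumes "x \<in> carrier G" "x [^] n = \<one>"
  shows "x [^] (k mod n :: nat) = x [^] k"
proof -
  have "x [^] k = x [^] (n * (k div n) + k mod n)" by simp
  also have "\<dots> = x [^] (k mod n)"
    using assms by (simp only: nat_pow_mult[symmetric] nat_pow_pow[symmetric]) simp
  finally show ?thesis by simp
qed

section \<open>Coordinates of cocycles\<close>

locale two_cyclic =
  fixes p m1 m2 :: nat
  assumes p: "prime p" and m1: "0 < m1" "m1 \<le> m2" and p2: "p = 2 \<Longrightarrow> m1 > 1"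
begin

definition "n1 = int (p ^ m1)"
definition "n2 = int (p ^ m2)"
text \<open>The quotient \<open>n2 / n1\<close>. A homomorphism from the first cyclic factor to the
  second sends the generator to a multiple of \<open>q\<close>.\<close>

definition "q = int (p ^ (m2 - m1))"
definition "G = integer_mod_group (p ^ m1) \<times>\<times> integer_mod_group (p ^ m2)"
abbreviation "F \<equiv> residue_ring (int p)"

lemma p_gt1: "int p > 1" using prime_gt_1_nat[OF p] by simp

lemma n2_eq: "n2 = q * n1"
  using m1 by (simp add: n1_def n2_def q_def flip: power_add)

lemma p_dvd_n1: "int p dvd n1" using m1 by (simp add: n1_def dvd_power)
lemma p_dvd_n2: "int p dvd n2" using p_dvd_n1 by (simp add: n2_eq)

lemma n_pos: "q > 0" "n1 > 1" "n2 > 1"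
proof -
  show "q > 0" using p_gt1 by (simp add: q_def)
  show "n1 > 1" "n2 > 1"
    using p_gt1 m1 by (auto simp: n1_def n2_def intro!: one_less_power)
qed

lemma carrier_G: "carrier G = {0..<n1} \<times> {0..<n2}"
  using p_gt1 by (auto simp: G_def n1_def n2_def carrier_integer_mod_group)

lemma mult_G: "x \<otimes>\<^bsub>G\<^esub> y = ((fst x + fst y) mod n1, (snd x + snd y) mod n2)"
  by (cases x; cases y) (simp add: G_def n1_def n2_def)

lemma one_G: "\<one>\<^bsub>G\<^esub> = (0, 0)" by (simp add: G_def)

lemma comm_G: "comm_group G"
proof -
  have "group G" by (simp add: G_def DirProd_group)
  then show ?thesis
    by (rule group.group_comm_groupI) (auto simp: mult_G add.commute)
qed

sublocale R: residues "int p" F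
  by unfold_locales (use p_gt1 in simp_all)

lemmas F_simps = R.res_carrier_eq R.res_add_eq R.res_mult_eq R.res_zero_eq R.res_neg_eq a_minus_def

sublocale T: trivial_coeff G F
  using comm_G by (simp add: trivial_coeff_def comm_group_def R.ring_axioms)

text \<open>Starting the sum at \<open>k = 0\<close> suits cocycles that are not normalised: the
  \<open>p ^ m1\<close>-th power of the lift \<open>(0, (1, 0))\<close> has first component
  \<open>A1 c - c (0, 0)\<close> modulo \<open>p\<close>, where \<open>- c (0, 0)\<close> is that of
  the unit.\<close>

definition A1 :: "((int \<times> int) \<times> (int \<times> int) \<Rightarrow> int) \<Rightarrow> int" where
  "A1 c = (\<Sum>k<p ^ m1. c ((int k, 0), (1, 0))) mod int p"
definition A2 :: "((int \<times> int) \<times> (int \<times> int) \<Rightarrow> int) \<Rightarrow> int" where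
  "A2 c = (\<Sum>k<p ^ m2. c ((0, int k), (0, 1))) mod int p"
definition B :: "((int \<times> int) \<times> (int \<times> int) \<Rightarrow> int) \<Rightarrow> int" where
  "B c = (c ((1, 0), (0, 1)) - c ((0, 1), (1, 0))) mod int p"

definition "coords c = (A1 c, A2 c, B c)"

lemma int_lt_n: "k < p ^ m1 \<Longrightarrow> int k < n1" "k < p ^ m2 \<Longrightarrow> int k < n2"
  by (simp_all only: n1_def n2_def of_nat_less_iff)

lemma coords_add:
  "coords (\<lambda>u\<in>carrier G \<times> carrier G. c u \<oplus>\<^bsub>F\<^esub> d u)
    = ((A1 c + A1 d) mod int p, (A2 c + A2 d) mod int p, (B c + B d) mod int p)"
proof -
  let ?e = "\<lambda>u\<in>carrier G \<times> carrier G. c u \<oplus>\<^bsub>F\<^esub> d u"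
  have "A1 ?e = (\<Sum>k<p ^ m1. (c ((int k, 0), (1, 0)) + d ((int k, 0), (1, 0))) mod int p) mod int p"
    using n_pos by (auto simp: A1_def carrier_G int_lt_n F_simps intro!: arg_cong[of _ _ "\<lambda>x. x mod int p"] sum.cong)
  then have 1: "A1 ?e = (A1 c + A1 d) mod int p"
    by (simp add: A1_def mod_sum_eq sum.distrib mod_add_eq)
  have "A2 ?e = (\<Sum>k<p ^ m2. (c ((0, int k), (0, 1)) + d ((0, int k), (0, 1))) mod int p) mod int p"
    using n_pos by (auto simp: A2_def carrier_G int_lt_n F_simps intro!: arg_cong[of _ _ "\<lambda>x. x mod int p"] sum.cong)
  then have 2: "A2 ?e = (A2 c + A2 d) mod int p"
    by (simp add: A2_def mod_sum_eq sum.distrib mod_add_eq)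
  have 3: "B ?e = (B c + B d) mod int p"
    using n_pos by (simp add: B_def carrier_G F_simps mod_simps) (simp add: algebra_simps)
  show ?thesis by (simp add: coords_def 1 2 3)
qed

text \<open>The sum telescopes around a cycle: the shift permutes the residues, its last value
  wrapping around to \<open>0\<close>.\<close>

lemma sum_succ_mod_diff:
  fixes h :: "int \<Rightarrow> int"
  assumes "n > 0"
  shows "(\<Sum>k<n. h (int k) - h ((int k + 1) mod int n)) = 0"
proof -
  have "(\<Sum>k<n. h ((int k + 1) mod int n)) = (\<Sum>k<n. h (int k))"
  proof -
    obtain m where n: "n = Suc m" using assms by (cases n) auto
    have "(\<Sum>k<m. h ((int k + 1) mod int n)) = (\<Sum>k<m. h (int (Suc k)))"
      by (rule sum.cong) (auto simp: n add.commute)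
    moreover have "h ((int m + 1) mod int n) = h (int 0)"
      by (simp add: n add.commute)
    moreover have "(\<Sum>k<n. h (int k)) = h (int 0) + (\<Sum>k<m. h (int (Suc k)))"
      unfolding n by (rule sum.lessThan_Suc_shift)
    moreover have "(\<Sum>k<n. h ((int k + 1) mod int n))
        = (\<Sum>k<m. h ((int k + 1) mod int n)) + h ((int m + 1) mod int n)"
      unfolding n by (rule sum.lessThan_Suc)
    ultimately show ?thesis by linarith
  qed
  then show ?thesis by (simp add: sum_subtractf)
qed

text \<open>In \<open>A1\<close> and \<open>A2\<close> the cyclic differences cancel and leave
  \<open>n1 * h (1, 0)\<close> and \<open>n2 * h (0, 1)\<close>, multiples of \<open>p\<close>;
  \<open>B\<close> vanishes because \<open>G\<close> is commutative. Hence the coordinates depend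
  only on the cohomology class.\<close>

lemma coords_coboundary:
  assumes "c \<in> coboundaries2 G F"
  shows "coords c = (0, 0, 0)"
proof -
  obtain h where c: "c = coboundary2 G F h" using assms by (auto simp: coboundaries2_def)
  have val: "c (x, y) = (h x + h y - h (x \<otimes>\<^bsub>G\<^esub> y)) mod int p"
    if "x \<in> carrier G" "y \<in> carrier G" for x y
    using that by (simp add: c coboundary2_def F_simps mod_simps)
  have "A1 c = (\<Sum>k<p ^ m1. (h (int k, 0) + h (1, 0) - h ((int k + 1) mod n1, 0)) mod int p) mod int p"
    unfolding A1_def
    using n_pos by (auto simp: val carrier_G mult_G int_lt_n intro!: arg_cong[of _ _ "\<lambda>x. x mod int p"] sum.cong)
  also have "\<dots> = (\<Sum>k<p ^ m1. h (1, 0) + (h (int k, 0) - h ((int k + 1) mod n1, 0))) mod int p"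
    by (simp add: mod_sum_eq algebra_simps)
  also have "\<dots> = n1 * h (1, 0) mod int p"
    using sum_succ_mod_diff[of "p ^ m1" "\<lambda>k. h (k, 0)"] p_gt1
    by (subst sum.distrib) (simp add: n1_def)
  finally have 1: "A1 c = 0" using p_dvd_n1 by simp
  have "A2 c = (\<Sum>k<p ^ m2. (h (0, int k) + h (0, 1) - h (0, (int k + 1) mod n2)) mod int p) mod int p"
    unfolding A2_def
    using n_pos by (auto simp: val carrier_G mult_G int_lt_n intro!: arg_cong[of _ _ "\<lambda>x. x mod int p"] sum.cong)
  also have "\<dots> = (\<Sum>k<p ^ m2. h (0, 1) + (h (0, int k) - h (0, (int k + 1) mod n2))) mod int p"
    by (simp add: mod_sum_eq algebra_simps)
  also have "\<dots> = n2 * h (0, 1) mod int p"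
    using sum_succ_mod_diff[of "p ^ m2" "\<lambda>k. h (0, k)"] p_gt1
    by (subst sum.distrib) (simp add: n2_def)
  finally have 2: "A2 c = 0" using p_dvd_n2 by simp
  have 3: "B c = 0"
    using n_pos by (simp add: B_def val carrier_G mult_G mod_simps algebra_simps)
  show ?thesis by (simp add: coords_def 1 2 3)
qed

text \<open>The lifts \<open>t1\<close>, \<open>t2\<close> of the generators commute and have orders
  dividing \<open>p ^ m1\<close>, \<open>p ^ m2\<close>. So \<open>s (i, j) = t1^i t2^j\<close> is a
  homomorphic section of the extension, and a split extension comes from a coboundary.\<close>

lemma coboundaryI:
  assumes c: "c \<in> cocycles2 G F" and c0: "coords c = (0, 0, 0)"
  shows "c \<in> coboundaries2 G F"
proof -
  define E where "E = central_extension G F c"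
  interpret E: group E unfolding E_def by (rule T.group_central_extension[OF c])
  have cF: "0 \<le> c (x, y) \<and> c (x, y) < int p" if "x \<in> carrier G" "y \<in> carrier G" for x y
    using T.cocycleD[OF c that] by (auto simp: F_simps)
  have carE: "carrier E = {0..int p - 1} \<times> carrier G"
    by (simp add: E_def central_extension_def F_simps)
  have mulE: "X \<otimes>\<^bsub>E\<^esub> Y = ((fst X + fst Y + c (snd X, snd Y)) mod int p, snd X \<otimes>\<^bsub>G\<^esub> snd Y)" for X Y
    by (cases X; cases Y) (simp add: E_def central_extension_def F_simps mod_simps)
  have oneE: "\<one>\<^bsub>E\<^esub> = (- c ((0, 0), (0, 0)) mod int p, (0, 0))"
    by (simp add: E_def central_extension_def F_simps one_G)
  define t1 t2 where "t1 = (0 :: int, (1 :: int, 0 :: int))" and "t2 = (0 :: int, (0 :: int, 1 :: int))"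
  have t [simp]: "t1 \<in> carrier E" "t2 \<in> carrier E"
    using p_gt1 n_pos by (auto simp: t1_def t2_def carE carrier_G)
  \<comment> \<open>The bound on \<open>k\<close> keeps every index \<open>j < k\<close> reduced
    modulo \<open>n1\<close>; the summand \<open>- c (0, 0)\<close> comes from the zeroth power, the
    unit.\<close>
  have pow1: "t1 [^]\<^bsub>E\<^esub> k = (((\<Sum>j<k. c ((int j, 0), (1, 0))) - c ((0, 0), (0, 0))) mod int p,
      (int k mod n1, 0))" if "k \<le> p ^ m1" for k
    using that
  proof (induction k)
    case (Suc k)
    then have "int k mod n1 = int k" using int_lt_n(1)[of k] by simp
    with Suc show ?case
      by (simp add: mulE) (simp add: t1_def mult_G mod_simps algebra_simps)
  qed (simp add: oneE)
  have pow2: "t2 [^]\<^bsub>E\<^esub> k = (((\<Sum>j<k. c ((0, int j), (0, 1))) - c ((0, 0), (0, 0))) mod int p,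
      (0, int k mod n2))" if "k \<le> p ^ m2" for k
    using that
  proof (induction k)
    case (Suc k)
    then have "int k mod n2 = int k" using int_lt_n(2)[of k] by simp
    with Suc show ?case
      by (simp add: mulE) (simp add: t2_def mult_G mod_simps algebra_simps)
  qed (simp add: oneE)
  have ord1: "t1 [^]\<^bsub>E\<^esub> (p ^ m1) = \<one>\<^bsub>E\<^esub>"
  proof -
    have "(\<Sum>j<p ^ m1. c ((int j, 0), (1, 0))) mod int p = 0"
      using c0 by (simp add: coords_def A1_def)
    then show ?thesis
      by (simp add: pow1 oneE n1_def mod_diff_left_eq[symmetric])
  qed
  have ord2: "t2 [^]\<^bsub>E\<^esub> (p ^ m2) = \<one>\<^bsub>E\<^esub>"
  proof -
    have "(\<Sum>j<p ^ m2. c ((0, int j), (0, 1))) mod int p = 0"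
      using c0 by (simp add: coords_def A2_def)
    then show ?thesis
      by (simp add: pow2 oneE n2_def mod_diff_left_eq[symmetric])
  qed
  have "c ((1, 0), (0, 1)) mod int p = c ((0, 1), (1, 0)) mod int p"
    using c0 by (simp add: coords_def B_def mod_eq_dvd_iff mod_0_imp_dvd)
  then have "t1 \<otimes>\<^bsub>E\<^esub> t2 = t2 \<otimes>\<^bsub>E\<^esub> t1"
    by (simp add: mulE) (simp add: t1_def t2_def mult_G)
  then have comm: "t2 [^]\<^bsub>E\<^esub> j \<otimes>\<^bsub>E\<^esub> t1 [^]\<^bsub>E\<^esub> i = t1 [^]\<^bsub>E\<^esub> i \<otimes>\<^bsub>E\<^esub> t2 [^]\<^bsub>E\<^esub> j" for i j :: nat
    by (intro E.group_commutes_pow E.group_commutes_pow[symmetric]) auto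
  define s where "s x = t1 [^]\<^bsub>E\<^esub> nat (fst x) \<otimes>\<^bsub>E\<^esub> t2 [^]\<^bsub>E\<^esub> nat (snd x)" for x :: "int \<times> int"
  have s_car: "s x \<in> carrier E" for x by (simp add: s_def)
  have s_snd: "snd (s x) = x" if "x \<in> carrier G" for x
  proof -
    have "nat (fst x) \<le> p ^ m1" "nat (snd x) \<le> p ^ m2"
      using that by (auto simp: carrier_G n1_def n2_def nat_le_iff)
    then show ?thesis
      using that by (auto simp: s_def mulE mult_G pow1 pow2 carrier_G)
  qed
  have s_mult: "s (x \<otimes>\<^bsub>G\<^esub> y) = s x \<otimes>\<^bsub>E\<^esub> s y" if xy: "x \<in> carrier G" "y \<in> carrier G" for x y
  proof -
    obtain i j i' j' where x: "x = (int i, int j)" and y: "y = (int i', int j')"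
      using xy by (auto simp: carrier_G) (metis nat_0_le)
    have "nat ((int i + int i') mod n1) = (i + i') mod p ^ m1"
      "nat ((int j + int j') mod n2) = (j + j') mod p ^ m2"
      unfolding n1_def n2_def of_nat_add[symmetric] of_nat_mod[symmetric] by (rule nat_int)+
    then have "s (x \<otimes>\<^bsub>G\<^esub> y) = t1 [^]\<^bsub>E\<^esub> (i + i') \<otimes>\<^bsub>E\<^esub> t2 [^]\<^bsub>E\<^esub> (j + j')"
      by (simp add: s_def mult_G x y E.pow_mod ord1 ord2)
    also have "\<dots> = (t1 [^]\<^bsub>E\<^esub> i \<otimes>\<^bsub>E\<^esub> t1 [^]\<^bsub>E\<^esub> i') \<otimes>\<^bsub>E\<^esub> (t2 [^]\<^bsub>E\<^esub> j \<otimes>\<^bsub>E\<^esub> t2 [^]\<^bsub>E\<^esub> j')"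
      by (simp add: E.nat_pow_mult)
    also have "\<dots> = t1 [^]\<^bsub>E\<^esub> i \<otimes>\<^bsub>E\<^esub> (t1 [^]\<^bsub>E\<^esub> i' \<otimes>\<^bsub>E\<^esub> t2 [^]\<^bsub>E\<^esub> j) \<otimes>\<^bsub>E\<^esub> t2 [^]\<^bsub>E\<^esub> j'"
      by (simp add: E.m_assoc)
    also have "\<dots> = s x \<otimes>\<^bsub>E\<^esub> s y"
      unfolding comm[symmetric] by (simp add: s_def x y E.m_assoc)
    finally show ?thesis .
  qed
  \<comment> \<open>With \<open>f\<close> the first component of \<open>s\<close>, multiplicativity
    says \<open>f (x y) = f x + f y + c (x, y)\<close>, so \<open>- f\<close> has coboundary
    \<open>c\<close>.\<close>
  define h where "h x = - fst (s x) mod int p" for x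
  have "c = coboundary2 G F h"
  proof
    fix u
    show "c u = coboundary2 G F h u"
    proof (cases "u \<in> carrier G \<times> carrier G")
      case True
      then obtain x y where u: "u = (x, y)" and xy: "x \<in> carrier G" "y \<in> carrier G" by auto
      have "h x \<oplus>\<^bsub>F\<^esub> h y \<ominus>\<^bsub>F\<^esub> h (x \<otimes>\<^bsub>G\<^esub> y) = (fst (s (x \<otimes>\<^bsub>G\<^esub> y)) - fst (s x) - fst (s y)) mod int p"
        by (simp add: h_def F_simps mod_simps algebra_simps)
      also have "\<dots> = c (x, y)"
        using cF[OF xy] by (simp add: s_mult[OF xy] mulE s_snd xy diff_diff_eq mod_simps)
      finally show ?thesis using xy by (simp add: u coboundary2_def)
    next
      case False
      moreover have "c \<in> extensional (carrier G \<times> carrier G)"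
        using c by (simp add: cocycles2_def cochain_group2_def PiE_def)
      ultimately show ?thesis by (simp add: coboundary2_def extensional_arb[of c])
    qed
  qed
  moreover have "h \<in> carrier G \<rightarrow> carrier F"
    using p_gt1 by (auto simp: h_def F_simps)
  ultimately show ?thesis by (auto simp: coboundaries2_def)
qed

end

section \<open>Carries in the addition of residues\<close>

lemma div_add_mod_carry:
  fixes x y n :: int
  assumes "n \<noteq> 0"
  shows "(x mod n + y) div n + x div n = (x + y) div n"
proof -
  have "x + y = (x mod n + y) + x div n * n" by simp
  then have "(x + y) div n = ((x mod n + y) + x div n * n) div n" by metis
  with div_mult_self1[OF assms, of "x mod n + y" "x div n"] show ?thesis by linarith
qed

text \<open>Adding \<open>x\<close> to a running residue \<open>N\<close> times produces carries
  that telescope to the quotient of \<open>N * x\<close> by \<open>n\<close>.\<close>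

lemma sum_carries:
  fixes x n :: int
  assumes "n \<noteq> 0"
  shows "(\<Sum>j<N. (int j * x mod n + x) div n) = int N * x div n"
proof (induction N)
  case (Suc N)
  then show ?case
    using div_add_mod_carry[OF assms, of "int N * x" x] by (simp add: algebra_simps)
qed simp

context two_cyclic
begin

lemma int_p_pow: "int p ^ m1 = n1" "int p ^ m2 = n2"
  by (simp_all add: n1_def n2_def)

text \<open>The sum is \<open>p ^ m * (p ^ m - 1) / 2\<close>. For odd \<open>p\<close> the number
  \<open>2\<close> is invertible modulo \<open>p\<close>; for \<open>p = 2\<close> the exponent is
  at least \<open>2\<close>, so a factor \<open>2\<close> survives the halving.\<close>

lemma p_dvd_sum:
  assumes "m1 \<le> m"
  shows "int p dvd (\<Sum>j<p ^ m. int j)"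
proof (cases "p = 2")
  case True
  have "m \<ge> 2" using p2[OF True] assms by simp
  then obtain l where m: "m = Suc (Suc l)" by (metis Suc_le_D numeral_2_eq_2 Suc_le_mono)
  have "(\<Sum>j<n. int j) * 2 = int n * (int n - 1)" for n
    by (induction n) (auto simp: algebra_simps)
  from this[of "p ^ m"] have "(\<Sum>j<p ^ m. int j) = 2 * (2 ^ l * (2 ^ m - 1))"
    by (simp add: True m)
  then show ?thesis by (simp add: True)
next
  case False
  have "(\<Sum>j<n. int j) * 2 = int n * (int n - 1)" for n
    by (induction n) (auto simp: algebra_simps)
  moreover have "int p dvd int (p ^ m)" using assms m1 by (simp add: dvd_power)
  ultimately have "int p dvd (\<Sum>j<p ^ m. int j) * 2" by simp
  moreover have "coprime (int p) 2"
    using p False by (metis coprime_int_iff of_nat_numeral primes_coprime two_is_prime_nat)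
  ultimately show ?thesis by (simp add: coprime_dvd_mult_left_iff)
qed

text \<open>The cocycle of \<open>H\<^sup>2\<close> with coordinates \<open>(a1, a2, b)\<close>: the two carry cocycles of the cyclic
  factors and the cup product of the two projections.\<close>

definition std :: "int \<Rightarrow> int \<Rightarrow> int \<Rightarrow> (int \<times> int) \<times> (int \<times> int) \<Rightarrow> int" where
  "std a1 a2 b = (\<lambda>(x, y)\<in>carrier G \<times> carrier G.
     (a1 * ((fst x + fst y) div n1) + a2 * ((snd x + snd y) div n2) + b * (fst x * snd y)) mod int p)"

lemma mod_n_mod_p: "x mod n1 mod int p = x mod int p" "x mod n2 mod int p = x mod int p"
  using p_dvd_n1 p_dvd_n2 by (simp_all add: mod_mod_cancel)

lemma mod_n_mult_mod_p:
  "(a * (x mod n1)) mod int p = (a * x) mod int p" "(a * (x mod n2)) mod int p = (a * x) mod int p"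
  by (metis mod_n_mod_p mod_mult_right_eq)+

text \<open>The carry terms satisfy the cocycle identity over the integers. The product term does so
  modulo \<open>p\<close>, where reduction modulo \<open>n1\<close> or \<open>n2\<close> is
  invisible and the product is bilinear.\<close>

lemma std_cocycle: "std a1 a2 b \<in> cocycles2 G F"
proof -
  have carry: "(y + z) div n + (x + (y + z) mod n) div n = ((x + y) mod n + z) div n + (x + y) div n"
    if "n \<noteq> 0" for x y z n :: int
    using div_add_mod_carry[OF that, of "y + z" x] div_add_mod_carry[OF that, of "x + y" z]
    by (simp add: algebra_simps)
  have n: "n1 \<noteq> 0" "n2 \<noteq> 0" using n_pos by auto
  have "(std a1 a2 b (y, z) + std a1 a2 b (x, y \<otimes>\<^bsub>G\<^esub> z)) mod int p
      = (std a1 a2 b (x \<otimes>\<^bsub>G\<^esub> y, z) + std a1 a2 b (x, y)) mod int p"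
    if xyz: "x \<in> carrier G" "y \<in> carrier G" "z \<in> carrier G" for x y z
  proof -
    have G: "x \<otimes>\<^bsub>G\<^esub> y \<in> carrier G" "y \<otimes>\<^bsub>G\<^esub> z \<in> carrier G" using xyz by simp_all
    have cup: "[b * (fst y * snd z) + b * (fst x * ((snd y + snd z) mod n2))
        = b * (((fst x + fst y) mod n1) * snd z) + b * (fst x * snd y)] (mod int p)"
    proof -
      have "[b * (fst x * ((snd y + snd z) mod n2)) = b * (fst x * (snd y + snd z))] (mod int p)"
        by (intro cong_mult cong_refl) (simp add: cong_def mod_n_mod_p)
      moreover have "[b * (((fst x + fst y) mod n1) * snd z) = b * ((fst x + fst y) * snd z)] (mod int p)"
        by (intro cong_mult cong_refl) (simp add: cong_def mod_n_mod_p)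
      ultimately have "[b * (fst y * snd z) + b * (fst x * ((snd y + snd z) mod n2))
        = b * (fst y * snd z) + b * (fst x * (snd y + snd z))] (mod int p)"
        "[b * (((fst x + fst y) mod n1) * snd z) + b * (fst x * snd y)
        = b * ((fst x + fst y) * snd z) + b * (fst x * snd y)] (mod int p)"
        by (simp_all add: cong_add)
      moreover have "b * (fst y * snd z) + b * (fst x * (snd y + snd z))
        = b * ((fst x + fst y) * snd z) + b * (fst x * snd y)" by (simp add: algebra_simps)
      ultimately show ?thesis by (simp add: cong_def)
    qed
    have "[(a1 * ((fst y + fst z) div n1 + (fst x + (fst y + fst z) mod n1) div n1)
          + a2 * ((snd y + snd z) div n2 + (snd x + (snd y + snd z) mod n2) div n2))
        + (b * (fst y * snd z) + b * (fst x * ((snd y + snd z) mod n2)))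
      = (a1 * (((fst x + fst y) mod n1 + fst z) div n1 + (fst x + fst y) div n1)
          + a2 * (((snd x + snd y) mod n2 + snd z) div n2 + (snd x + snd y) div n2))
        + (b * (((fst x + fst y) mod n1) * snd z) + b * (fst x * snd y))] (mod int p)"
      unfolding carry[OF n(1)] carry[OF n(2)] by (intro cong_add cong_refl cup)
    then have "(a1 * ((fst y + fst z) div n1) + a2 * ((snd y + snd z) div n2) + b * (fst y * snd z)
        + (a1 * ((fst x + (fst y + fst z) mod n1) div n1) + a2 * ((snd x + (snd y + snd z) mod n2) div n2)
          + b * (fst x * ((snd y + snd z) mod n2)))) mod int p
      = (a1 * (((fst x + fst y) mod n1 + fst z) div n1) + a2 * (((snd x + snd y) mod n2 + snd z) div n2)
          + b * (((fst x + fst y) mod n1) * snd z)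
        + (a1 * ((fst x + fst y) div n1) + a2 * ((snd x + snd y) div n2) + b * (fst x * snd y))) mod int p"
      unfolding cong_def by (simp add: distrib_left add_ac)
    then show ?thesis
      using xyz G unfolding std_def by (simp add: mult_G mod_add_eq)
  qed
  moreover have "std a1 a2 b \<in> carrier (cochain_group2 G F)"
    using p_gt1 by (auto simp: cochain_group2_def std_def F_simps)
  ultimately show ?thesis
    by (simp add: cocycles2_def F_simps)
qed

section \<open>Endomorphisms of \<open>G\<close> and their effect on the coordinates of a
  cocycle\<close>

lemma hom_G_apply:
  assumes t: "t \<in> hom G G" and ij: "0 \<le> i" "i < n1" "0 \<le> j" "j < n2"
  shows "t (i, j) = ((i * fst (t (1, 0)) + j * fst (t (0, 1))) mod n1,
    (i * snd (t (1, 0)) + j * snd (t (0, 1))) mod n2)"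
proof -
  have e: "(1, 0) \<in> carrier G" "(0, 1) \<in> carrier G" "(0, 0) \<in> carrier G" using n_pos by (auto simp: carrier_G)
  have t0: "t (0, 0) = (0, 0)"
    using group_hom.hom_one[of G G t] t comm_G
    by (simp add: group_hom_def group_hom_axioms_def comm_group_def one_G)
  have t1: "t (int k, 0) = (int k * fst (t (1, 0)) mod n1, int k * snd (t (1, 0)) mod n2)"
    if "int k < n1" for k
    using that
  proof (induction k)
    case (Suc k)
    then have "(int k, 0) \<in> carrier G" using n_pos by (auto simp: carrier_G)
    then have "t ((int k, 0) \<otimes>\<^bsub>G\<^esub> (1, 0)) = t (int k, 0) \<otimes>\<^bsub>G\<^esub> t (1, 0)"
      using t e by (simp add: hom_mult)
    with Suc show ?case by (simp add: mult_G mod_simps algebra_simps)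
  qed (simp add: t0)
  have t2: "t (0, int k) = (int k * fst (t (0, 1)) mod n1, int k * snd (t (0, 1)) mod n2)"
    if "int k < n2" for k
    using that
  proof (induction k)
    case (Suc k)
    then have "(0, int k) \<in> carrier G" using n_pos by (auto simp: carrier_G)
    then have "t ((0, int k) \<otimes>\<^bsub>G\<^esub> (0, 1)) = t (0, int k) \<otimes>\<^bsub>G\<^esub> t (0, 1)"
      using t e by (simp add: hom_mult)
    with Suc show ?case by (simp add: mult_G mod_simps algebra_simps)
  qed (simp add: t0)
  have "t (i, j) = t ((i, 0) \<otimes>\<^bsub>G\<^esub> (0, j))" using ij by (simp add: mult_G)
  also have "\<dots> = t (i, 0) \<otimes>\<^bsub>G\<^esub> t (0, j)"
    using t ij n_pos by (intro hom_mult) (auto simp: carrier_G)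
  also have "\<dots> = ((i * fst (t (1, 0)) + j * fst (t (0, 1))) mod n1,
    (i * snd (t (1, 0)) + j * snd (t (0, 1))) mod n2)"
    using t1[of "nat i"] t2[of "nat j"] ij by (simp add: mult_G mod_simps)
  finally show ?thesis .
qed

text \<open>The generator \<open>(1, 0)\<close> is killed by \<open>n1\<close>, so
  \<open>n2 = q * n1\<close> divides \<open>n1\<close> times the second component of its
  image.\<close>

lemma q_dvd_hom:
  assumes t: "t \<in> hom G G"
  shows "q dvd snd (t (1, 0))"
proof -
  have e: "(1, 0) \<in> carrier G" "(n1 - 1, 0) \<in> carrier G" using n_pos by (auto simp: carrier_G)
  have "0 = snd (t (0, 0))" using hom_G_apply[OF t, of 0 0] n_pos by simp
  \<comment> \<open>Zero is split as a sum of reduced elements, since \<open>hom_G_apply\<close>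
    speaks only of reduced arguments.\<close>
  also have "(0, 0) = (n1 - 1, 0) \<otimes>\<^bsub>G\<^esub> (1, 0)" by (simp add: mult_G)
  also have "t ((n1 - 1, 0) \<otimes>\<^bsub>G\<^esub> (1, 0)) = t (n1 - 1, 0) \<otimes>\<^bsub>G\<^esub> t (1, 0)"
    using t e by (intro hom_mult)
  also have "snd (t (n1 - 1, 0) \<otimes>\<^bsub>G\<^esub> t (1, 0)) = (n1 * snd (t (1, 0))) mod n2"
    using n_pos by (subst hom_G_apply[OF t]) (simp_all add: mult_G mod_simps algebra_simps)
  finally have "n2 dvd n1 * snd (t (1, 0))" by (simp add: dvd_eq_mod_eq_0)
  then show ?thesis
    using n_pos by (simp add: n2_eq mult.commute)
qed

text \<open>Adding \<open>x1\<close> modulo \<open>n1\<close> and \<open>x2\<close> modulo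
  \<open>n2\<close>, each \<open>n1\<close> times, produces \<open>x1\<close> and
  \<open>x2 div q\<close> carries; adding \<open>y1\<close> and \<open>y2\<close>, each
  \<open>n2\<close> times, produces \<open>q * y1\<close> and \<open>y2\<close>. The product term
  contributes a multiple of the sum of all indices, which \<open>p\<close> divides. Antisymmetrising
  it yields the determinant in \<open>B\<close>.\<close>

lemma coords_twist:
  assumes t: "t \<in> hom G G"
    and x: "t (1, 0) = (x1, x2)" and y: "t (0, 1) = (y1, y2)"
  shows "coords (\<lambda>(x, y)\<in>carrier G \<times> carrier G. k \<otimes>\<^bsub>F\<^esub> std a1 a2 b (t x, t y))
    = (k * (a1 * x1 + a2 * (x2 div q)) mod int p,
       k * (a1 * (q * y1) + a2 * y2) mod int p,
       k * (b * (x1 * y2 - x2 * y1)) mod int p)"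
proof -
  define c where "c = (\<lambda>(x, y)\<in>carrier G \<times> carrier G. k \<otimes>\<^bsub>F\<^esub> std a1 a2 b (t x, t y))"
  \<comment> \<open>Only the product term may lose its reduction modulo \<open>n1\<close>; the
    carries depend on it.\<close>
  have mm: "(k * (u + b * (z mod n1 * w))) mod int p = (k * (u + b * (z * w))) mod int p" for u z w
    unfolding cong_def[symmetric]
    by (intro cong_mult cong_add cong_refl) (simp add: cong_def mod_n_mod_p)
  have drop: "(k * (u + b * (S * z * w))) mod int p = (k * u) mod int p" if "int p dvd S" for u S z w
  proof -
    have "k * (u + b * (S * z * w)) - k * u = S * (k * b * z * w)" by (simp add: algebra_simps)
    then show ?thesis using that by (simp add: mod_eq_dvd_iff)
  qed
  have tc: "t x \<in> carrier G" if "x \<in> carrier G" for x using t that by (auto simp: hom_def)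
  have val: "c (x, y) = (k * (a1 * ((fst (t x) + fst (t y)) div n1)
      + a2 * ((snd (t x) + snd (t y)) div n2) + b * (fst (t x) * snd (t y)))) mod int p"
    if "x \<in> carrier G" "y \<in> carrier G" for x y
    using that tc by (simp add: c_def std_def F_simps mod_simps)
  have e: "(1, 0) \<in> carrier G" "(0, 1) \<in> carrier G" using n_pos by (auto simp: carrier_G)
  have "A1 c = (\<Sum>j<p ^ m1. (k * (a1 * ((int j * x1 mod n1 + x1) div n1)
      + a2 * ((int j * x2 mod n2 + x2) div n2) + b * (int j * x1 mod n1 * x2))) mod int p) mod int p"
    unfolding A1_def
    using n_pos e by (auto simp: val carrier_G int_lt_n hom_G_apply[OF t] x y
        intro!: arg_cong[of _ _ "\<lambda>x. x mod int p"] sum.cong)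
  also have "\<dots> = (\<Sum>j<p ^ m1. (k * (a1 * ((int j * x1 mod n1 + x1) div n1)
      + a2 * ((int j * x2 mod n2 + x2) div n2) + b * (int j * x1 * x2))) mod int p) mod int p"
    by (simp only: mm)
  also have "\<dots> = (k * (a1 * (\<Sum>j<p ^ m1. (int j * x1 mod n1 + x1) div n1)
      + a2 * (\<Sum>j<p ^ m1. (int j * x2 mod n2 + x2) div n2)
      + b * ((\<Sum>j<p ^ m1. int j) * x1 * x2))) mod int p"
    by (simp add: mod_sum_eq sum_distrib_left sum_distrib_right sum.distrib distrib_left mult.assoc)
  also have "\<dots> = (k * (a1 * (n1 * x1 div n1) + a2 * (n1 * x2 div n2)
      + b * ((\<Sum>j<p ^ m1. int j) * x1 * x2))) mod int p"
    using n_pos by (simp add: sum_carries int_p_pow)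
  also have "n1 * x1 div n1 = x1" using n_pos by simp
  also have "n1 * x2 div n2 = x2 div q" using n_pos by (simp add: n2_eq mult.commute)
  also have "(k * (a1 * x1 + a2 * (x2 div q) + b * ((\<Sum>j<p ^ m1. int j) * x1 * x2))) mod int p
    = (k * (a1 * x1 + a2 * (x2 div q))) mod int p"
    by (rule drop) (rule p_dvd_sum, simp)
  finally have 1: "A1 c = (k * (a1 * x1 + a2 * (x2 div q))) mod int p" .
  have "A2 c = (\<Sum>j<p ^ m2. (k * (a1 * ((int j * y1 mod n1 + y1) div n1)
      + a2 * ((int j * y2 mod n2 + y2) div n2) + b * (int j * y1 mod n1 * y2))) mod int p) mod int p"
    unfolding A2_def
    using n_pos e by (auto simp: val carrier_G int_lt_n hom_G_apply[OF t] x y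
        intro!: arg_cong[of _ _ "\<lambda>x. x mod int p"] sum.cong)
  also have "\<dots> = (\<Sum>j<p ^ m2. (k * (a1 * ((int j * y1 mod n1 + y1) div n1)
      + a2 * ((int j * y2 mod n2 + y2) div n2) + b * (int j * y1 * y2))) mod int p) mod int p"
    by (simp only: mm)
  also have "\<dots> = (k * (a1 * (\<Sum>j<p ^ m2. (int j * y1 mod n1 + y1) div n1)
      + a2 * (\<Sum>j<p ^ m2. (int j * y2 mod n2 + y2) div n2)
      + b * ((\<Sum>j<p ^ m2. int j) * y1 * y2))) mod int p"
    by (simp add: mod_sum_eq sum_distrib_left sum_distrib_right sum.distrib distrib_left mult.assoc)
  also have "\<dots> = (k * (a1 * (n2 * y1 div n1) + a2 * (n2 * y2 div n2)
      + b * ((\<Sum>j<p ^ m2. int j) * y1 * y2))) mod int p"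
    using n_pos by (simp add: sum_carries int_p_pow)
  also have "n2 * y1 div n1 = q * y1" using n_pos by (simp add: n2_eq mult.commute mult.left_commute)
  also have "n2 * y2 div n2 = y2" using n_pos by simp
  also have "(k * (a1 * (q * y1) + a2 * y2 + b * ((\<Sum>j<p ^ m2. int j) * y1 * y2))) mod int p
    = (k * (a1 * (q * y1) + a2 * y2)) mod int p"
    by (rule drop) (rule p_dvd_sum, rule m1)
  finally have 2: "A2 c = (k * (a1 * (q * y1) + a2 * y2)) mod int p" .
  have 3: "B c = (k * (b * (x1 * y2 - x2 * y1))) mod int p"
    unfolding B_def val[OF e(1) e(2)] val[OF e(2) e(1)] x y
    by (simp add: mod_diff_eq algebra_simps)
  show ?thesis unfolding c_def[symmetric] by (simp add: coords_def 1 2 3)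
qed

text \<open>The twist formula for the identity and the scalar \<open>1\<close>.\<close>

lemma coords_std: "coords (std a1 a2 b) = (a1 mod int p, a2 mod int p, b mod int p)"
proof -
  have "std a1 a2 b = (\<lambda>(x, y)\<in>carrier G \<times> carrier G. 1 \<otimes>\<^bsub>F\<^esub> std a1 a2 b (id x, id y))"
    by (rule ext) (auto simp: std_def F_simps)
  moreover have "coords \<dots> = (1 * (a1 * 1 + a2 * (0 div q)) mod int p,
       1 * (a1 * (q * 0) + a2 * 1) mod int p, 1 * (b * (1 * 1 - 0 * 0)) mod int p)"
    by (rule coords_twist) (auto simp: hom_def)
  ultimately show ?thesis by simp
qed

section \<open>Coordinates on cohomology\<close>

definition P :: "int set" where "P = {0..<int p}"

text \<open>Evaluated at a chosen representative; \<open>H2_coords_class\<close> shows that the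
  choice does not matter.\<close>

definition H2_coords :: "((int \<times> int) \<times> (int \<times> int) \<Rightarrow> int) set \<Rightarrow> int \<times> int \<times> int" where
  "H2_coords X = coords (SOME c. c \<in> X)"

lemma coords_in: "coords c \<in> P \<times> P \<times> P"
  using p_gt1 by (simp add: coords_def A1_def A2_def B_def P_def)

lemma P_mod: "x \<in> P \<Longrightarrow> x mod int p = x" "x mod int p \<in> P"
  using p_gt1 by (auto simp: P_def)

lemma coords_P:
  "A1 c mod int p = A1 c" "A2 c mod int p = A2 c" "B c mod int p = B c"
  by (simp_all add: A1_def A2_def B_def)

lemma H2_coords_class: "H2_coords (H2_class G F c) = coords c" if c: "c \<in> cocycles2 G F"
proof -
  have "(SOME d. d \<in> H2_class G F c) \<in> H2_class G F c"
    using T.mem_H2_class[OF c] by (rule someI[of "\<lambda>d. d \<in> H2_class G F c"])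
  then obtain d where d: "d \<in> coboundaries2 G F"
    "(SOME d. d \<in> H2_class G F c) = d \<otimes>\<^bsub>cocycle_group2 G F\<^esub> c"
    unfolding H2_class_def r_coset_def by auto
  show ?thesis
    using coords_coboundary[OF d(1)]
    by (simp only: H2_coords_def d(2) T.Z_simps coords_add) (simp add: coords_def coords_P)
qed

text \<open>The difference \<open>e\<close> of the two cocycles has zero coordinates, hence is a
  coboundary. Its coordinates are found by cancelling in \<open>e + d = c\<close>.\<close>

lemma H2_class_eqI_coords:
  assumes c: "c \<in> cocycles2 G F" and d: "d \<in> cocycles2 G F" and eq: "coords c = coords d"
  shows "H2_class G F c = H2_class G F d"
proof -
  let ?Z = "cocycle_group2 G F"
  interpret Z: comm_group ?Z by (rule T.Z_comm_group)
  define e where "e = c \<otimes>\<^bsub>?Z\<^esub> inv\<^bsub>?Z\<^esub> d"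
  have cd: "c \<in> carrier ?Z" "d \<in> carrier ?Z" using c d by simp_all
  have e: "e \<in> carrier ?Z" unfolding e_def by (intro Z.m_closed Z.inv_closed cd)
  have ed: "e \<otimes>\<^bsub>?Z\<^esub> d = c"
    unfolding e_def by (simp only: Z.m_assoc Z.inv_closed Z.l_inv Z.r_one cd)
  have "coords (e \<otimes>\<^bsub>?Z\<^esub> d)
      = ((A1 e + A1 d) mod int p, (A2 e + A2 d) mod int p, (B e + B d) mod int p)"
    unfolding T.Z_simps(2) by (rule coords_add)
  then have "coords d = ((A1 e + A1 d) mod int p, (A2 e + A2 d) mod int p, (B e + B d) mod int p)"
    by (simp only: ed eq)
  then have "(A1 e + A1 d) mod int p = A1 d mod int p" "(A2 e + A2 d) mod int p = A2 d mod int p"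
    "(B e + B d) mod int p = B d mod int p"
    by (simp_all add: coords_def coords_P)
  then have "int p dvd A1 e" "int p dvd A2 e" "int p dvd B e"
    by (auto simp: mod_eq_dvd_iff)
  then have "coords e = (0, 0, 0)"
    by (metis coords_P coords_def dvd_eq_mod_eq_0)
  then have "e \<in> coboundaries2 G F" using e by (intro coboundaryI) simp_all
  then have "c \<in> H2_class G F d"
    using ed unfolding H2_class_def r_coset_def by blast
  then show ?thesis by (rule T.H2_class_eqI[OF d])
qed

text \<open>Normal form: a cocycle is cohomologous to the \<open>std\<close> cocycle with the same
  coordinates.\<close>

lemma H2_carrier_std: "carrier (H2 G F) = {H2_class G F (std a1 a2 b) | a1 a2 b. True}"
proof -
  have "H2_class G F c = H2_class G F (std (A1 c) (A2 c) (B c))" if "c \<in> cocycles2 G F" for c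
    by (rule H2_class_eqI_coords[OF that std_cocycle]) (simp add: coords_std coords_P, simp add: coords_def)
  then have "H2_class G F ` cocycles2 G F \<subseteq> {H2_class G F (std a1 a2 b) | a1 a2 b. True}"
    by blast
  moreover have "{H2_class G F (std a1 a2 b) | a1 a2 b. True} \<subseteq> H2_class G F ` cocycles2 G F"
    using std_cocycle by blast
  ultimately show ?thesis unfolding T.H2_carrier by (rule equalityI)
qed

lemma std_in_H2: "H2_class G F (std a1 a2 b) \<in> carrier (H2 G F)"
  by (simp add: T.H2_carrier std_cocycle)

lemma H2_coords_std: "H2_coords (H2_class G F (std a1 a2 b)) = (a1 mod int p, a2 mod int p, b mod int p)"
  by (simp add: H2_coords_class std_cocycle coords_std)

lemma H2_coords_bij: "bij_betw H2_coords (carrier (H2 G F)) (P \<times> P \<times> P)"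
proof (rule bij_betwI')
  fix X Y assume "X \<in> carrier (H2 G F)" "Y \<in> carrier (H2 G F)"
  then obtain c d where "c \<in> cocycles2 G F" "d \<in> cocycles2 G F" "X = H2_class G F c" "Y = H2_class G F d"
    by (auto simp: T.H2_carrier)
  then show "(H2_coords X = H2_coords Y) = (X = Y)"
    using H2_class_eqI_coords by (metis H2_coords_class)
next
  fix X assume "X \<in> carrier (H2 G F)"
  then show "H2_coords X \<in> P \<times> P \<times> P" using coords_in by (auto simp only: T.H2_carrier H2_coords_class)
next
  fix v assume "v \<in> P \<times> P \<times> P"
  then have "v = H2_coords (H2_class G F (std (fst v) (fst (snd v)) (snd (snd v))))"
    by (auto simp: H2_coords_std P_mod)
  then show "\<exists>X\<in>carrier (H2 G F). v = H2_coords X" using std_in_H2 by (rule bexI)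
qed

lemma H2_coords_mult:
  assumes "X \<in> carrier (H2 G F)" "Y \<in> carrier (H2 G F)"
    and "H2_coords X = (a1, a2, b)" "H2_coords Y = (a1', a2', b')"
  shows "H2_coords (X \<otimes>\<^bsub>H2 G F\<^esub> Y) = ((a1 + a1') mod int p, (a2 + a2') mod int p, (b + b') mod int p)"
proof -
  interpret Z: comm_group "cocycle_group2 G F" by (rule T.Z_comm_group)
  obtain c d where cd: "c \<in> cocycles2 G F" "d \<in> cocycles2 G F"
    "X = H2_class G F c" "Y = H2_class G F d" using assms(1,2) by (auto simp: T.H2_carrier)
  have "(\<lambda>u\<in>carrier G \<times> carrier G. c u \<oplus>\<^bsub>F\<^esub> d u) \<in> cocycles2 G F"
    using Z.m_closed[of c d] cd by simp
  then show ?thesis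
    using assms(3,4) by (simp add: cd T.H2_class_mult H2_coords_class coords_add) (simp add: coords_def)
qed

text \<open>The unit equals its own square, so each coordinate satisfies \<open>x + x = x\<close>
  modulo \<open>p\<close>.\<close>

lemma H2_coords_one: "H2_coords \<one>\<^bsub>H2 G F\<^esub> = (0, 0, 0)"
proof -
  interpret H: comm_group "H2 G F" by (rule T.H2_comm_group)
  obtain a1 a2 b where K1: "H2_coords \<one>\<^bsub>H2 G F\<^esub> = (a1, a2, b)" by (metis prod_cases3)
  have "(a1, a2, b) \<in> P \<times> P \<times> P"
    using bij_betwE[OF H2_coords_bij] H.one_closed K1 by metis
  then have "(a1 + a1) mod int p = a1 mod int p" "(a2 + a2) mod int p = a2 mod int p"
    "(b + b) mod int p = b mod int p" "a1 \<in> P" "a2 \<in> P" "b \<in> P"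
    using H2_coords_mult[OF _ _ K1 K1] K1 by (auto simp: P_mod)
  moreover have "x = 0" if "(x + x) mod int p = x mod int p" "x \<in> P" for x
    using that P_mod(1)[of x] by (metis add_diff_cancel_right' dvd_imp_mod_0 mod_eq_dvd_iff)
  ultimately show ?thesis by (simp add: K1)
qed

text \<open>The action pulls back along the inverse of \<open>s\<close>, so
  \<open>coords_twist\<close> applies to the images of the generators under that inverse, with a
  \<open>std\<close> cocycle as representative.\<close>

lemma H2_coords_act:
  assumes st: "(s, k) \<in> carrier (aut_units G F)"
    and x: "inv_into (carrier G) s (1, 0) = (x1, x2)"
    and y: "inv_into (carrier G) s (0, 1) = (y1, y2)"
    and X: "X \<in> carrier (H2 G F)" and cX: "H2_coords X = (a1, a2, b)"
  shows "H2_act G F (s, k) X \<in> carrier (H2 G F)"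
    "H2_coords (H2_act G F (s, k) X) = (k * (a1 * x1 + a2 * (x2 div q)) mod int p,
       k * (a1 * (q * y1) + a2 * y2) mod int p,
       k * (b * (x1 * y2 - x2 * y1)) mod int p)"
proof -
  obtain a1' a2' b' where X': "X = H2_class G F (std a1' a2' b')"
    using X by (auto simp: H2_carrier_std)
  have X2: "X = H2_class G F (std a1 a2 b)"
    unfolding X' using cX
    by (intro H2_class_eqI_coords std_cocycle) (auto simp: X' H2_coords_std coords_std)
  have act: "H2_act G F (s, k) X = H2_class G F (cochain_act G F (s, k) (std a1 a2 b))"
    unfolding X2 by (rule T.H2_act_class[OF st std_cocycle])
  have coc: "cochain_act G F (s, k) (std a1 a2 b) \<in> cocycles2 G F"
    by (rule T.cochain_act_cocycle[OF st std_cocycle])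
  show "H2_act G F (s, k) X \<in> carrier (H2 G F)"
    unfolding act using coc by (auto simp: T.H2_carrier)
  have e: "(1, 0) \<in> carrier G" "(0, 1) \<in> carrier G" using n_pos by (auto simp: carrier_G)
  have "H2_coords (H2_act G F (s, k) X) = coords (cochain_act G F (s, k) (std a1 a2 b))"
    unfolding act by (rule H2_coords_class[OF coc])
  also have "\<dots> = (k * (a1 * x1 + a2 * (x2 div q)) mod int p,
       k * (a1 * (q * y1) + a2 * y2) mod int p,
       k * (b * (x1 * y2 - x2 * y1)) mod int p)"
    unfolding T.cochain_act_eq
    by (rule coords_twist[OF T.aut_unitsD(4)[OF st]]) (use x y e in simp_all)
  finally show "H2_coords (H2_act G F (s, k) X) = (k * (a1 * x1 + a2 * (x2 div q)) mod int p,
       k * (a1 * (q * y1) + a2 * y2) mod int p,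
       k * (b * (x1 * y2 - x2 * y1)) mod int p)" .
qed

section \<open>Abelian classes and cup products in coordinates\<close>

lemma H2_ab_iff:
  assumes X: "X \<in> carrier (H2 G F)"
  shows "X \<in> H2_ab G F \<longleftrightarrow> snd (snd (H2_coords X)) = 0"
proof
  assume "X \<in> H2_ab G F"
  then obtain c where c: "X = H2_class G F c" "c \<in> cocycles2 G F"
    and "comm_group (central_extension G F c)" unfolding H2_ab_def by blast
  then have "\<forall>x\<in>carrier G. \<forall>y\<in>carrier G. c (x, y) = c (y, x)"
    using T.comm_group_central_extension_iff[OF _ comm_G] by blast
  moreover have "(1, 0) \<in> carrier G" "(0, 1) \<in> carrier G" using n_pos by (auto simp: carrier_G)
  ultimately have "B c = 0" by (simp add: B_def)
  then show "snd (snd (H2_coords X)) = 0" using c by (simp add: H2_coords_class coords_def)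
next
  assume K0: "snd (snd (H2_coords X)) = 0"
  obtain a1 a2 b where Xs: "X = H2_class G F (std a1 a2 b)"
    using X by (auto simp: H2_carrier_std)
  \<comment> \<open>With \<open>b = 0\<close> only the carry terms remain, and these are
    symmetric.\<close>
  have "X = H2_class G F (std a1 a2 0)"
    unfolding Xs using K0 by (intro H2_class_eqI_coords std_cocycle) (simp add: Xs H2_coords_std coords_std)
  moreover have "comm_group (central_extension G F (std a1 a2 0))"
    by (subst T.comm_group_central_extension_iff[OF std_cocycle comm_G]) (simp add: std_def add.commute)
  ultimately show "X \<in> H2_ab G F"
    using std_cocycle[of a1 a2 0] unfolding H2_ab_def by blast
qed

text \<open>On multiples of a generator \<open>f\<close> is linear, so the power coordinates are
  multiples of the sum of all indices and vanish modulo \<open>p\<close>.\<close>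

lemma coords_cup:
  assumes f: "f \<in> hom G (add_monoid F)" and g: "g \<in> hom G (add_monoid F)"
  shows "cup G F f g \<in> cocycles2 G F" "A1 (cup G F f g) = 0" "A2 (cup G F f g) = 0"
proof -
  have fg: "f x \<in> P" "g x \<in> P" if "x \<in> carrier G" for x
    using f g that by (auto simp: hom_def F_simps P_def Pi_iff)
  have m: "f (x \<otimes>\<^bsub>G\<^esub> y) = (f x + f y) mod int p" "g (x \<otimes>\<^bsub>G\<^esub> y) = (g x + g y) mod int p"
    if "x \<in> carrier G" "y \<in> carrier G" for x y
    using f g that by (auto simp: hom_def F_simps)
  have e: "(1, 0) \<in> carrier G" "(0, 1) \<in> carrier G" "(0, 0) \<in> carrier G"
    using n_pos by (auto simp: carrier_G)
  have f0: "f (0, 0) = 0"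
  proof -
    have "f (0, 0) mod int p = (f (0, 0) + f (0, 0)) mod int p"
      using m(1)[OF e(3) e(3)] fg(1)[OF e(3)] by (simp add: mult_G P_mod)
    then have "f (0, 0) mod int p = 0" by (metis add_diff_cancel_right' dvd_imp_mod_0 mod_eq_dvd_iff)
    then show ?thesis using fg(1)[OF e(3)] by (simp add: P_mod)
  qed
  have f1: "f (int k, 0) = int k * f (1, 0) mod int p" if "int k < n1" for k
    using that
  proof (induction k)
    case (Suc k)
    then have "(int k, 0) \<in> carrier G" using n_pos by (auto simp: carrier_G)
    from m(1)[OF this e(1)] Suc show ?case by (simp add: mult_G mod_simps algebra_simps)
  qed (simp add: f0)
  have f2: "f (0, int k) = int k * f (0, 1) mod int p" if "int k < n2" for k
    using that
  proof (induction k)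
    case (Suc k)
    then have "(0, int k) \<in> carrier G" using n_pos by (auto simp: carrier_G)
    from m(1)[OF this e(2)] Suc show ?case by (simp add: mult_G mod_simps algebra_simps)
  qed (simp add: f0)
  have "A1 (cup G F f g) = (\<Sum>j<p ^ m1. int j * (f (1, 0) * g (1, 0)) mod int p) mod int p"
    unfolding A1_def using n_pos
    by (auto simp: cup_def carrier_G F_simps f1 int_lt_n mod_simps mult.assoc
        intro!: arg_cong[of _ _ "\<lambda>x. x mod int p"] sum.cong)
  also have "\<dots> = ((\<Sum>j<p ^ m1. int j) * (f (1, 0) * g (1, 0))) mod int p"
    by (simp add: mod_sum_eq sum_distrib_right)
  finally show "A1 (cup G F f g) = 0" using p_dvd_sum[of m1] by simp
  have "A2 (cup G F f g) = (\<Sum>j<p ^ m2. int j * (f (0, 1) * g (0, 1)) mod int p) mod int p"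
    unfolding A2_def using n_pos
    by (auto simp: cup_def carrier_G F_simps f2 int_lt_n mod_simps mult.assoc
        intro!: arg_cong[of _ _ "\<lambda>x. x mod int p"] sum.cong)
  also have "\<dots> = ((\<Sum>j<p ^ m2. int j) * (f (0, 1) * g (0, 1))) mod int p"
    by (simp add: mod_sum_eq sum_distrib_right)
  finally show "A2 (cup G F f g) = 0" using p_dvd_sum[of m2] m1 by simp
  have "cup G F f g \<in> carrier (cochain_group2 G F)"
    using p_gt1 by (auto simp: cochain_group2_def cup_def F_simps)
  moreover have "(f y * g z + f x * ((g y + g z) mod int p)) mod int p
      = ((f x + f y) mod int p * g z + f x * g y) mod int p" for x y z
  proof -
    have "[f y * g z + f x * ((g y + g z) mod int p) = f y * g z + f x * (g y + g z)] (mod int p)"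
      "[(f x + f y) mod int p * g z + f x * g y = (f x + f y) * g z + f x * g y] (mod int p)"
      by (intro cong_add cong_mult cong_refl; simp add: cong_def)+
    then show ?thesis by (simp add: cong_def algebra_simps)
  qed
  ultimately show "cup G F f g \<in> cocycles2 G F"
    by (simp add: cocycles2_def cup_def F_simps m mod_add_eq)
qed

text \<open>The cup classes already fill the whole line \<open>a1 = a2 = 0\<close>, which is closed
  under the group operations and scalars, so it is its own span.\<close>

lemma span_cup: "H2_span G F (Im_cup G F) = {X \<in> carrier (H2 G F). \<exists>b. H2_coords X = (0, 0, b)}"
proof -
  interpret H: comm_group "H2 G F" by (rule T.H2_comm_group)
  let ?V = "{X \<in> carrier (H2 G F). \<exists>b. H2_coords X = (0, 0, b)}"
  have sub: "Im_cup G F \<subseteq> ?V"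
  proof
    fix X assume "X \<in> Im_cup G F"
    then obtain f g where X: "X = H2_class G F (cup G F f g)"
      and fg: "f \<in> hom G (add_monoid F)" "g \<in> hom G (add_monoid F)"
      by (auto simp: Im_cup_def)
    note c = coords_cup[OF fg]
    show "X \<in> ?V"
      using c by (simp add: X H2_coords_class coords_def T.H2_carrier)
  qed
  have sup: "?V \<subseteq> Im_cup G F"
  proof
    fix X assume X: "X \<in> ?V"
    then obtain b where b: "H2_coords X = (0, 0, b)" by blast
    \<comment> \<open>A multiple of the first projection and the second projection, both modulo
      \<open>p\<close>; the commutator coordinate of their cup product is \<open>b\<close>.\<close>
    define f g where "f x = (b * fst x) mod int p" and "g x = snd x mod int p" for x :: "int \<times> int"
    have fg: "f \<in> hom G (add_monoid F)" "g \<in> hom G (add_monoid F)"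
      using p_gt1
      by (auto simp: hom_def f_def g_def F_simps mult_G mod_n_mod_p mod_n_mult_mod_p mod_simps
          distrib_left)
    note c = coords_cup[OF fg]
    obtain d where d: "d \<in> cocycles2 G F" "X = H2_class G F d"
      using X by (auto simp: T.H2_carrier)
    have "b \<in> P" using bij_betwE[OF H2_coords_bij] X b by auto
    then have "B (cup G F f g) = b"
      using n_pos p_gt1 by (simp add: B_def cup_def carrier_G f_def g_def F_simps P_mod)
    then have "X = H2_class G F (cup G F f g)"
      using b c unfolding d(2) by (intro H2_class_eqI_coords d) (auto simp: coords_def H2_coords_class d)
    then show "X \<in> Im_cup G F" using fg by (auto simp: Im_cup_def)
  qed
  have "subgroup ?V (H2 G F)"
  proof (rule H.subgroupI)
    show "?V \<noteq> {}" using H2_coords_one by auto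
    fix X assume X: "X \<in> ?V"
    then obtain b where b: "H2_coords X = (0, 0, b)" by blast
    obtain a1 a2 b' where i: "H2_coords (inv\<^bsub>H2 G F\<^esub> X) = (a1, a2, b')" by (metis prod_cases3)
    have "H2_coords (X \<otimes>\<^bsub>H2 G F\<^esub> inv\<^bsub>H2 G F\<^esub> X) = (0, 0, 0)" using X H2_coords_one by simp
    then have "a1 mod int p = 0" "a2 mod int p = 0"
      using H2_coords_mult[OF _ _ b i] X by auto
    moreover have "(a1, a2, b') \<in> P \<times> P \<times> P"
      using bij_betwE[OF H2_coords_bij] H.inv_closed X i by (metis (mono_tags, lifting) mem_Collect_eq)
    ultimately show "inv\<^bsub>H2 G F\<^esub> X \<in> ?V" using X i by (auto simp: P_mod)
  next
    fix X Y assume "X \<in> ?V" "Y \<in> ?V"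
    then show "X \<otimes>\<^bsub>H2 G F\<^esub> Y \<in> ?V" by (auto simp: H2_coords_mult)
  qed auto
  moreover have "H2_smult G F k X \<in> ?V" if kX: "k \<in> carrier F" "X \<in> ?V" for k X
  proof -
    obtain b where b: "H2_coords X = (0, 0, b)" using kX by blast
    obtain d where d: "d \<in> cocycles2 G F" "X = H2_class G F d"
      using kX by (auto simp: T.H2_carrier)
    have "X = H2_class G F (std 0 0 b)"
      unfolding d(2) using b d
      by (intro H2_class_eqI_coords std_cocycle) (auto simp: H2_coords_class coords_std, auto simp: coords_def coords_P)
    then have "H2_smult G F k X = H2_class G F (cochain_smult G F k (std 0 0 b))"
      using T.H2_smult_class[OF kX(1) std_cocycle] by simp
    also have "cochain_smult G F k (std 0 0 b) = std 0 0 (k * b)"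
      by (rule ext) (auto simp: cochain_smult_def std_def F_simps mod_simps mult.assoc)
    finally show ?thesis by (simp add: H2_coords_std std_in_H2)
  qed
  ultimately have "H2_span G F (Im_cup G F) \<subseteq> ?V"
    using sub unfolding H2_span_def by (intro Inter_lower) auto
  moreover have "?V \<subseteq> H2_span G F (Im_cup G F)"
    using sup unfolding H2_span_def by blast
  ultimately show ?thesis by blast
qed

end

section \<open>Automorphisms and orbits\<close>

text \<open>One column of the matrix is free; it is used to adjust the determinant, which equals
  \<open>(a1' z - a2' v) / a1\<close>.\<close>

lemma exists_matrix_cong_aux:
  fixes a1 a2 a1' a2' d p :: int
  assumes p: "prime p" and a: "\<not> p dvd a1" and a': "\<not> (p dvd a1' \<and> p dvd a2')"
  shows "\<exists>u v w z. [a1 * u + a2 * v = a1'] (mod p) \<and> [a1 * w + a2 * z = a2'] (mod p)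
    \<and> [u * z - v * w = d] (mod p)"
proof -
  have inv: "\<exists>i e. x * i = 1 + p * e" if x: "\<not> p dvd x" for x
  proof -
    have "coprime x p" using p x by (simp add: prime_imp_coprime coprime_commute)
    then obtain i where "[x * i = 1] (mod p)" using cong_solve_coprime_int by blast
    then obtain e where "x * i - 1 = p * e" unfolding cong_iff_dvd_diff by (auto elim: dvdE)
    then have "x * i = 1 + p * e" by simp
    then show ?thesis by blast
  qed
  have c: "[x = y] (mod p)" if "x = y + p * e" for x y e :: int
    using that by (simp add: cong_iff_dvd_diff)
  obtain i e where i: "a1 * i = 1 + p * e" using inv[OF a] by blast
  show ?thesis
  proof (cases "p dvd a1'")
    case False
    then obtain j f where j: "a1' * j = 1 + p * f" using inv by blast
    show ?thesis
    proof (intro exI conjI)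
      \<comment> \<open>Here \<open>v = 0\<close>, \<open>u = a1' / a1\<close> and
        \<open>z = d * a1 / a1'\<close> modulo \<open>p\<close>; the second equation then forces
        \<open>w\<close>.\<close>
      have "a1 * (a1' * i) + a2 * 0 = a1' + p * (e * a1')"
        using i by Groebner_Basis.algebra
      then show "[a1 * (a1' * i) + a2 * 0 = a1'] (mod p)" by (rule c)
      have "a1 * ((a2' - d * a1 * j * a2) * i) + a2 * (d * a1 * j) = a2' + p * (e * (a2' - d * a1 * j * a2))"
        using i by Groebner_Basis.algebra
      then show "[a1 * ((a2' - d * a1 * j * a2) * i) + a2 * (d * a1 * j) = a2'] (mod p)" by (rule c)
      have "a1' * i * (d * a1 * j) - 0 * ((a2' - d * a1 * j * a2) * i) = d + p * (d * e + d * f + p * d * e * f)"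
        using i j by Groebner_Basis.algebra
      then show "[a1' * i * (d * a1 * j) - 0 * ((a2' - d * a1 * j * a2) * i) = d] (mod p)" by (rule c)
    qed
  next
    case True
    with a' have "\<not> p dvd a2'" by simp
    then obtain j f where j: "a2' * j = 1 + p * f" using inv by blast
    show ?thesis
    proof (intro exI conjI)
      \<comment> \<open>Now \<open>a2'\<close> is invertible: \<open>z = 0\<close>,
        \<open>w = a2' / a1\<close> and \<open>v = - d * a1 / a2'\<close> modulo \<open>p\<close>;
        the first equation then forces \<open>u\<close>.\<close>
      have "a1 * ((a1' + d * a1 * j * a2) * i) + a2 * (- d * a1 * j) = a1' + p * (e * (a1' + d * a1 * j * a2))"
        using i by Groebner_Basis.algebra
      then show "[a1 * ((a1' + d * a1 * j * a2) * i) + a2 * (- d * a1 * j) = a1'] (mod p)" by (rule c)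
      have "a1 * (a2' * i) + a2 * 0 = a2' + p * (e * a2')"
        using i by Groebner_Basis.algebra
      then show "[a1 * (a2' * i) + a2 * 0 = a2'] (mod p)" by (rule c)
      have "(a1' + d * a1 * j * a2) * i * 0 - (- d * a1 * j) * (a2' * i) = d + p * (d * e + d * f + p * d * e * f)"
        using i j by Groebner_Basis.algebra
      then show "[(a1' + d * a1 * j * a2) * i * 0 - (- d * a1 * j) * (a2' * i) = d] (mod p)" by (rule c)
    qed
  qed
qed

text \<open>If \<open>p\<close> divides \<open>a1\<close>, the roles of \<open>a1\<close> and
  \<open>a2\<close> are exchanged. This swaps the columns of the matrix and negates its determinant,
  hence the call with \<open>- d\<close>.\<close>

lemma exists_matrix_cong:
  fixes a1 a2 a1' a2' d p :: int
  assumes p: "prime p" and a: "\<not> (p dvd a1 \<and> p dvd a2)" and a': "\<not> (p dvd a1' \<and> p dvd a2')"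
  shows "\<exists>u v w z. [a1 * u + a2 * v = a1'] (mod p) \<and> [a1 * w + a2 * z = a2'] (mod p)
    \<and> [u * z - v * w = d] (mod p)"
proof (cases "p dvd a1")
  case False
  then show ?thesis using exists_matrix_cong_aux[OF p _ a'] by blast
next
  case True
  with a have "\<not> p dvd a2" by blast
  from exists_matrix_cong_aux[OF p this a', of a1 "- d"] obtain u v w z where
    uv: "[a2 * u + a1 * v = a1'] (mod p)" "[a2 * w + a1 * z = a2'] (mod p)" "[u * z - v * w = - d] (mod p)"
    by blast
  then have "[v * w - u * z = d] (mod p)"
    using cong_minus_minus_iff[of "u * z - v * w" "- d" p] by simp
  then show ?thesis
    using uv by (intro exI[of _ v] exI[of _ u] exI[of _ z] exI[of _ w]) (simp add: add.commute)
qed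

text \<open>The rows of the adjugate, up to sign \<open>(z, - v)\<close> and
  \<open>(w, - u)\<close>, annihilate a singular matrix; if both vanish modulo \<open>p\<close>, so
  does the matrix, and \<open>(1, 0)\<close> works.\<close>

lemma exists_left_kernel_mod:
  fixes u v w z p :: int
  assumes p: "prime p" and D: "p dvd u * z - v * w"
  shows "\<exists>r s. \<not> (p dvd r \<and> p dvd s) \<and> p dvd r * u + s * w \<and> p dvd r * v + s * z"
proof (cases "p dvd z \<and> p dvd v")
  case False
  then show ?thesis
    using D by (intro exI[of _ z] exI[of _ "- v"]) (auto simp: algebra_simps)
next
  case zv: True
  show ?thesis
  proof (cases "p dvd w \<and> p dvd u")
    case False
    then show ?thesis
      using D dvd_minus_iff[of p "u * z - v * w"]
      by (intro exI[of _ w] exI[of _ "- u"]) (auto simp: algebra_simps)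
  next
    case True
    then show ?thesis
      using zv p by (intro exI[of _ 1] exI[of _ 0]) (auto simp: not_prime_unit)
  qed
qed

context two_cyclic
begin

lemma prime_int_p: "prime (int p)" using p by simp

lemma coprime_p: "\<not> int p dvd x \<Longrightarrow> coprime x (int p)"
  by (metis coprime_commute prime_imp_coprime prime_int_p)

lemma coprime_n:
  assumes "\<not> int p dvd d"
  shows "coprime n1 d" "coprime n2 d"
  using assms prime_int_p by (auto simp: n1_def n2_def prime_imp_coprime)

text \<open>A singular matrix modulo \<open>p\<close> would give a nontrivial element of the socle in the kernel.\<close>

lemma det_not_dvd:
  assumes t: "t \<in> hom G G" and inj: "inj_on t (carrier G)"
    and x: "t (1, 0) = (x1, x2)" and y: "t (0, 1) = (y1, y2)"
  shows "\<not> int p dvd x1 * y2 - x2 * y1"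
proof
  assume D: "int p dvd x1 * y2 - x2 * y1"
  define v where "v = x2 div q"
  have x2: "x2 = q * v" using q_dvd_hom[OF t] by (simp add: v_def x)
  \<comment> \<open>Moving the factor \<open>q\<close> turns this into the determinant of the matrix
    with rows \<open>(x1, v)\<close> and \<open>(q * y1, y2)\<close>.\<close>
  have "x1 * y2 - x2 * y1 = x1 * y2 - v * (q * y1)" by (simp add: x2)
  with D obtain r s where rs: "\<not> (int p dvd r \<and> int p dvd s)"
    and "int p dvd r * x1 + s * (q * y1)" "int p dvd r * v + s * y2"
    using exists_left_kernel_mod[OF prime_int_p, of x1 y2 v "q * y1"] by auto
  then obtain \<alpha> \<beta> where \<alpha>: "r * x1 + s * (q * y1) = int p * \<alpha>" and \<beta>: "r * v + s * y2 = int p * \<beta>"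
    by (auto elim!: dvdE)
  define N where "N = int (p ^ (m1 - 1))"
  have N: "n1 = int p * N" "n2 = q * (int p * N)" "N > 0"
  proof -
    have "p ^ m1 = p * p ^ (m1 - 1)" using m1 by (simp flip: power_Suc)
    then show "n1 = int p * N" by (simp only: n1_def N_def of_nat_mult)
    then show "n2 = q * (int p * N)" by (simp add: n2_eq)
    show "N > 0" using p_gt1 by (simp add: N_def)
  qed
  \<comment> \<open>The kernel vector \<open>(r, s)\<close> is placed in the socle, whose generators
    are \<open>N\<close> and \<open>q * N\<close> in the two factors, and reduced to the
    carrier.\<close>
  define i j where "i = (r * N) mod n1" and "j = (s * (q * N)) mod n2"
  obtain k l where i: "i = r * N - n1 * k" and j: "j = s * (q * N) - n2 * l"
    using minus_mult_div_eq_mod i_def j_def by metis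
  have ij: "0 \<le> i" "i < n1" "0 \<le> j" "j < n2" using n_pos by (auto simp: i_def j_def)
  have e1: "i * x1 + j * y1 = n1 * (\<alpha> - k * x1 - q * l * y1)"
    using \<alpha> i j N(1,2) by Groebner_Basis.algebra
  have e2: "i * x2 + j * y2 = n2 * (\<beta> - k * v - l * y2)"
    using \<beta> i j N(1,2) x2 by Groebner_Basis.algebra
  have "t (i, j) = (0, 0)"
    using hom_G_apply[OF t ij] e1 e2 by (simp add: x y)
  moreover have "t (0, 0) = (0, 0)" using hom_G_apply[OF t, of 0 0] n_pos by simp
  ultimately have "t (i, j) = t (0, 0)" by simp
  moreover have "(i, j) \<in> carrier G" "(0, 0) \<in> carrier G" using ij n_pos by (simp_all add: carrier_G)
  ultimately have "(i, j) = (0, 0)" by (rule inj_onD[OF inj])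
  \<comment> \<open>Cancelling \<open>N\<close> and \<open>q * N\<close> shows that \<open>p\<close>
    divides both \<open>r\<close> and \<open>s\<close>, against their choice.\<close>
  then have "n1 dvd r * N" "n2 dvd s * (q * N)" by (simp_all add: i_def j_def dvd_eq_mod_eq_0)
  moreover have "n2 = int p * (q * N)" by (simp add: N(2))
  ultimately have "int p * N dvd r * N" "int p * (q * N) dvd s * (q * N)" unfolding N(1) by simp_all
  then have "int p dvd r" "int p dvd s"
    using N(3) n_pos(1) by (simp_all only: dvd_mult_cancel_right) simp_all
  with rs show False by simp
qed

section \<open>Pairs of an automorphism and a unit as matrices acting on coordinates\<close>

lemma unit_F_iff: "k \<in> Units F \<longleftrightarrow> k \<in> P \<and> \<not> int p dvd k"
proof -
  have "coprime k (int p) \<longleftrightarrow> \<not> int p dvd k"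
    using prime_int_p p_gt1 by (metis coprime_absorb_left coprime_commute not_prime_unit prime_imp_coprime)
  then show ?thesis
    unfolding R.res_units_eq P_def using p_gt1 by (auto simp: le_less)
qed

text \<open>The factor \<open>q\<close> is moved from \<open>x2\<close> to \<open>y1\<close>:
  \<open>v = x2 div q\<close> and \<open>w = q * y1\<close>. The determinant stays the same, and
  \<open>p\<close> divides \<open>w\<close> when \<open>m1 < m2\<close>.\<close>

lemma H2_coords_act_matrix:
  assumes g: "g \<in> carrier (aut_units G F)"
    and X: "X \<in> carrier (H2 G F)" and cX: "H2_coords X = (a1, a2, b)"
  shows "\<exists>k u v w z. \<not> int p dvd k \<and> \<not> int p dvd u * z - v * w \<and> (m1 < m2 \<longrightarrow> int p dvd w)
    \<and> H2_act G F g X \<in> carrier (H2 G F)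
    \<and> H2_coords (H2_act G F g X) = (k * (a1 * u + a2 * v) mod int p, k * (a1 * w + a2 * z) mod int p,
         k * (b * (u * z - v * w)) mod int p)"
proof -
  obtain s k where sk: "g = (s, k)" by (cases g)
  note st = g[unfolded sk]
  let ?t = "restrict (inv_into (carrier G) s) (carrier G)"
  have t: "?t \<in> hom G G" by (rule T.aut_unitsD(4)[OF st])
  have "bij_betw s (carrier G) (carrier G)"
    using T.aut_unitsD(1)[OF st] by (simp add: auto_def Bij_def)
  then have inj: "inj_on ?t (carrier G)"
    using bij_betw_inv_into[of s "carrier G" "carrier G"] by (simp add: bij_betw_def inj_on_restrict_eq)
  have e: "(1, 0) \<in> carrier G" "(0, 1) \<in> carrier G" using n_pos by (auto simp: carrier_G)
  obtain x1 x2 y1 y2 where x: "inv_into (carrier G) s (1, 0) = (x1, x2)"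
    and y: "inv_into (carrier G) s (0, 1) = (y1, y2)" by fastforce
  have D: "\<not> int p dvd x1 * y2 - x2 * y1"
    using det_not_dvd[OF t inj] e x y by simp
  have x2: "x2 = x2 div q * q" using q_dvd_hom[OF t] e x by simp
  then have x2y1: "x2 * y1 = x2 div q * (q * y1)" by (metis mult.assoc)
  have "int p dvd q * y1" if "m1 < m2" using that by (simp add: q_def dvd_power)
  moreover have "\<not> int p dvd k" using T.aut_unitsD(2)[OF st] by (simp add: unit_F_iff)
  ultimately show ?thesis
    using H2_coords_act[OF st x y X cX] D unfolding sk x2y1
    by (intro exI[of _ k] exI[of _ x1] exI[of _ "x2 div q"] exI[of _ "q * y1"] exI[of _ y2] conjI impI)
qed

text \<open>The action involves the inverse of \<open>s\<close>, so the map \<open>t\<close> with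
  the prescribed images is built first and \<open>s\<close> is its inverse. Cramer's rule gives
  injectivity of \<open>t\<close>, and finiteness surjectivity.\<close>

lemma aut_from_matrix:
  assumes D: "\<not> int p dvd u * z - q * v * w"
  shows "\<exists>s. (s, 1) \<in> carrier (aut_units G F)
    \<and> inv_into (carrier G) s (1, 0) = (u mod n1, q * v mod n2)
    \<and> inv_into (carrier G) s (0, 1) = (w mod n1, z mod n2)"
proof -
  define t where "t = (\<lambda>(i, j)\<in>carrier G. ((i * u + j * w) mod n1, (i * (q * v) + j * z) mod n2))"
  have t_car: "t x \<in> carrier G" if "x \<in> carrier G" for x
    using that n_pos by (cases x) (auto simp: t_def carrier_G)
  have hom: "t \<in> hom G G"
  proof (rule homI)
    fix x y assume xy: "x \<in> carrier G" "y \<in> carrier G"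
    then have xyc: "x \<otimes>\<^bsub>G\<^esub> y \<in> carrier G" by simp
    obtain i j i' j' where x: "x = (i, j)" and y: "y = (i', j')" by (cases x; cases y)
    have "[(i mod n1) * u + (j mod n2) * w = i * u + j * w] (mod n1)" for i j
      by (intro cong_add cong_mult cong_refl) (simp_all add: cong_def n2_eq mod_mod_cancel)
    then have c1: "((i mod n1) * u + (j mod n2) * w) mod n1 = (i * u + j * w) mod n1" for i j
      by (simp add: cong_def)
    have "[(i mod n1) * (q * v) + (j mod n2) * z = i * (q * v) + j * z] (mod n2)" for i j
    proof -
      \<comment> \<open>The factor \<open>q\<close> carries congruence modulo \<open>n1\<close> to
        congruence modulo \<open>n2\<close>; it makes \<open>t\<close> compatible with
        reduction.\<close>
      have "(i mod n1) * q = (i * q) mod n2"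
        using mult_mod_right[of q i n1] by (simp add: n2_eq mult.commute)
      then have "[(i mod n1) * q = i * q] (mod n2)" by (simp add: cong_def)
      then have "[(i mod n1) * q * v = i * q * v] (mod n2)" by (rule cong_scalar_right)
      then have "[(i mod n1) * (q * v) = i * (q * v)] (mod n2)" by (simp only: mult.assoc)
      moreover have "[(j mod n2) * z = j * z] (mod n2)"
        by (intro cong_mult cong_refl) (simp add: cong_def)
      ultimately show ?thesis by (rule cong_add)
    qed
    then have c2: "((i mod n1) * (q * v) + (j mod n2) * z) mod n2 = (i * (q * v) + j * z) mod n2" for i j
      by (simp add: cong_def)
    have "t (x \<otimes>\<^bsub>G\<^esub> y)
        = (((i + i') * u + (j + j') * w) mod n1, ((i + i') * (q * v) + (j + j') * z) mod n2)"
      using xyc by (simp add: t_def mult_G x y c1 c2)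
    also have "\<dots> = t x \<otimes>\<^bsub>G\<^esub> t y"
      using xy by (simp add: t_def mult_G x y mod_add_eq) (simp add: algebra_simps)
    finally show "t (x \<otimes>\<^bsub>G\<^esub> y) = t x \<otimes>\<^bsub>G\<^esub> t y" .
  qed (rule t_car)
  have inj: "inj_on t (carrier G)"
  proof (rule inj_onI)
    fix x y assume xy: "x \<in> carrier G" "y \<in> carrier G" and eq: "t x = t y"
    obtain i j i' j' where x: "x = (i, j)" and y: "y = (i', j')" by (cases x; cases y)
    define k l where "k = i - i'" and "l = j - j'"
    have "n1 dvd k * u + l * w" "n2 dvd k * (q * v) + l * z"
      using eq xy by (simp_all add: t_def x y mod_eq_dvd_iff k_def l_def algebra_simps)
    then obtain \<alpha> \<beta> where \<alpha>: "k * u + l * w = n1 * \<alpha>" and \<beta>: "k * (q * v) + l * z = n2 * \<beta>"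
      by (auto elim!: dvdE)
    \<comment> \<open>Cramer's rule; the determinant is prime to \<open>p\<close> and can be
      cancelled from the divisibilities.\<close>
    have "k * (u * z - q * v * w) = n1 * (\<alpha> * z - q * \<beta> * w)"
      using \<alpha> \<beta> n2_eq by Groebner_Basis.algebra
    moreover have "l * (u * z - q * v * w) = n2 * (\<beta> * u - \<alpha> * v)"
      using \<alpha> \<beta> n2_eq by Groebner_Basis.algebra
    ultimately have "n1 dvd k * (u * z - q * v * w)" "n2 dvd l * (u * z - q * v * w)" by simp_all
    then have "n1 dvd k" "n2 dvd l"
      using coprime_n[OF D] by (simp_all add: coprime_dvd_mult_left_iff)
    moreover have "\<bar>k\<bar> < n1" "\<bar>l\<bar> < n2"
      using xy by (auto simp: carrier_G x y k_def l_def)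
    ultimately have "k = 0" "l = 0" by (auto dest: zdvd_not_zless[rotated] dvd_imp_le_int)
    then show "x = y" by (simp add: x y k_def l_def)
  qed
  have "t ` carrier G = carrier G"
  proof (rule endo_inj_surj[OF _ _ inj])
    show "finite (carrier G)" by (simp add: carrier_G)
    show "t ` carrier G \<subseteq> carrier G" using t_car by (rule image_subsetI)
  qed
  then have Bij: "t \<in> Bij (carrier G)"
    using inj by (simp add: Bij_def bij_betw_def) (simp add: t_def)
  define s where "s = restrict (inv_into (carrier G) t) (carrier G)"
  have s: "s \<in> hom G G" "s \<in> Bij (carrier G)"
    unfolding s_def by (rule T.G.restrict_inv_into_hom[OF hom Bij], rule restrict_inv_into_Bij[OF Bij])
  have inv: "inv_into (carrier G) s x = t x" if "x \<in> carrier G" for x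
  proof (rule inv_into_f_eq)
    show "inj_on s (carrier G)" using s(2) by (simp add: Bij_def bij_betw_def)
    show "t x \<in> carrier G" "s (t x) = x" using t_car[OF that] inj that by (simp_all add: s_def)
  qed
  have "(1 :: int) \<in> Units F" using p_gt1 by (simp add: unit_F_iff P_def)
  then have "(s, 1) \<in> carrier (aut_units G F)"
    using s by (simp add: aut_units_def AutoGroup_def auto_def units_of_def)
  moreover have "(1, 0) \<in> carrier G" "(0, 1) \<in> carrier G" using n_pos by (auto simp: carrier_G)
  ultimately show ?thesis by (intro exI[of _ s]) (simp add: inv t_def)
qed

text \<open>The scalar \<open>1\<close> is enough for transitivity, because the determinant of the
  matrix already rescales \<open>b\<close>.\<close>

lemma exists_act:
  assumes D: "\<not> int p dvd u * z - q * v * w"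
    and X: "X \<in> carrier (H2 G F)" and cX: "H2_coords X = (a1, a2, b)"
  shows "\<exists>g\<in>carrier (aut_units G F). H2_act G F g X \<in> carrier (H2 G F)
    \<and> H2_coords (H2_act G F g X) = ((a1 * u + a2 * v) mod int p, (a1 * (q * w) + a2 * z) mod int p,
        b * (u * z - q * v * w) mod int p)"
proof -
  obtain s where s: "(s, 1) \<in> carrier (aut_units G F)"
    and x: "inv_into (carrier G) s (1, 0) = (u mod n1, q * v mod n2)"
    and y: "inv_into (carrier G) s (0, 1) = (w mod n1, z mod n2)"
    using aut_from_matrix[OF D] by blast
  have v: "q * v mod n2 = q * (v mod n1)" unfolding n2_eq by (rule mod_mult_mult1)
  have v': "q * (v mod n1) div q = v mod n1" using n_pos by simp
  have c: "[u mod n1 = u] (mod int p)" "[v mod n1 = v] (mod int p)" "[w mod n1 = w] (mod int p)"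
    "[z mod n2 = z] (mod int p)" by (simp_all add: cong_def mod_n_mod_p)
  have "[a1 * (u mod n1) + a2 * (v mod n1) = a1 * u + a2 * v] (mod int p)"
    "[a1 * (q * (w mod n1)) + a2 * (z mod n2) = a1 * (q * w) + a2 * z] (mod int p)"
    "[b * ((u mod n1) * (z mod n2) - q * (v mod n1) * (w mod n1)) = b * (u * z - q * v * w)] (mod int p)"
    by (intro cong_add cong_mult cong_diff cong_refl c)+
  then have "H2_coords (H2_act G F (s, 1) X) = ((a1 * u + a2 * v) mod int p, (a1 * (q * w) + a2 * z) mod int p,
        b * (u * z - q * v * w) mod int p)"
    using H2_coords_act(2)[OF s x y X cX] unfolding v v' cong_def by (simp only: mult_1)
  then show ?thesis using H2_coords_act(1)[OF s x y X cX] s by blast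
qed

text \<open>Labels the orbits on pairs \<open>(a1, a2)\<close>: zero, the nonzero part of the line
  \<open>a2 = 0\<close>, the rest. That line is invariant only for \<open>m1 < m2\<close>; if
  \<open>m1 = m2\<close>, label \<open>1\<close> does not occur.\<close>

definition vtype :: "int \<Rightarrow> int \<Rightarrow> nat" where
  "vtype a1 a2 = (if a1 = 0 \<and> a2 = 0 then 0 else if m1 < m2 \<and> a2 = 0 then 1 else 2)"

definition Orb_set :: "nat \<Rightarrow> bool \<Rightarrow> ((int \<times> int) \<times> (int \<times> int) \<Rightarrow> int) set set" where
  "Orb_set i z = {X \<in> carrier (H2 G F). case H2_coords X of (a1, a2, b) \<Rightarrow> vtype a1 a2 = i \<and> (b = 0) = z}"

lemma P_dvd: "x \<in> P \<Longrightarrow> int p dvd x \<longleftrightarrow> x = 0"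
  by (metis P_mod(1) dvd_eq_mod_eq_0)

lemma dvd_iff_mod_p: "x mod int p = 0 \<longleftrightarrow> int p dvd x"
  by (simp add: dvd_eq_mod_eq_0)

lemma p_dvd_mult: "int p dvd x * y \<longleftrightarrow> int p dvd x \<or> int p dvd y"
  using prime_dvd_mult_iff[OF prime_int_p] .

text \<open>Vanishing of both entries is preserved by Cramer's rule. For \<open>m1 < m2\<close> the
  matrix is triangular modulo \<open>p\<close>, so \<open>z\<close> is invertible and multiplies
  \<open>a2\<close> up to the unit \<open>k\<close>.\<close>

lemma vtype_invariant:
  assumes a: "a1 \<in> P" "a2 \<in> P" and k: "\<not> int p dvd k" and D: "\<not> int p dvd u * z - v * w"
    and w: "m1 < m2 \<longrightarrow> int p dvd w"
  shows "vtype (k * (a1 * u + a2 * v) mod int p) (k * (a1 * w + a2 * z) mod int p) = vtype a1 a2"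
proof -
  have zero: "a1 = 0 \<and> a2 = 0 \<longleftrightarrow>
    int p dvd k * (a1 * u + a2 * v) \<and> int p dvd k * (a1 * w + a2 * z)"
  proof
    assume "int p dvd k * (a1 * u + a2 * v) \<and> int p dvd k * (a1 * w + a2 * z)"
    then have *: "int p dvd a1 * u + a2 * v" "int p dvd a1 * w + a2 * z"
      using k by (simp_all add: p_dvd_mult)
    have "a1 * (u * z - v * w) = (a1 * u + a2 * v) * z - (a1 * w + a2 * z) * v"
      "a2 * (u * z - v * w) = (a1 * w + a2 * z) * u - (a1 * u + a2 * v) * w"
      by (simp_all add: algebra_simps)
    then have "int p dvd a1 * (u * z - v * w)" "int p dvd a2 * (u * z - v * w)"
      using * by (metis dvd_diff dvd_mult2)+
    then show "a1 = 0 \<and> a2 = 0" using D a by (simp add: p_dvd_mult P_dvd)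
  qed simp
  have one: "a2 = 0 \<longleftrightarrow> int p dvd k * (a1 * w + a2 * z)" if "m1 < m2"
  proof -
    have w': "int p dvd w" using w that by simp
    then have "\<not> int p dvd z" using D by auto
    then show ?thesis
      using w' k a by (simp add: p_dvd_mult P_dvd dvd_add_right_iff)
  qed
  show ?thesis
    unfolding vtype_def dvd_iff_mod_p using zero one by auto
qed

text \<open>Invariance of the type and of \<open>b = 0\<close> gives one inclusion. For the other, a
  matrix of prescribed determinant must carry \<open>(a1, a2)\<close> to
  \<open>(a1', a2')\<close>.\<close>

lemma orbit_eq:
  assumes X: "X \<in> Orb_set i y"
  shows "orbit (aut_units G F) (H2_act G F) X = Orb_set i y"
proof
  obtain a1 a2 b where cX: "H2_coords X = (a1, a2, b)" by (metis prod_cases3)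
  have Xc: "X \<in> carrier (H2 G F)" and iy: "vtype a1 a2 = i" "(b = 0) = y"
    using X cX by (auto simp: Orb_set_def)
  have ab: "a1 \<in> P" "a2 \<in> P" "b \<in> P" using bij_betwE[OF H2_coords_bij] Xc cX by auto
  show "orbit (aut_units G F) (H2_act G F) X \<subseteq> Orb_set i y"
  proof
    fix Y assume "Y \<in> orbit (aut_units G F) (H2_act G F) X"
    then obtain g where g: "g \<in> carrier (aut_units G F)" and Y: "Y = H2_act G F g X"
      by (auto simp: orbit_def)
    from H2_coords_act_matrix[OF g Xc cX] obtain k u v w z where
      k: "\<not> int p dvd k" and D: "\<not> int p dvd u * z - v * w" and w: "m1 < m2 \<longrightarrow> int p dvd w"
      and Yc: "Y \<in> carrier (H2 G F)"
      and cY: "H2_coords Y = (k * (a1 * u + a2 * v) mod int p, k * (a1 * w + a2 * z) mod int p,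
         k * (b * (u * z - v * w)) mod int p)" unfolding Y by blast
    have "k * (b * (u * z - v * w)) mod int p = 0 \<longleftrightarrow> b = 0"
      using k D ab by (simp only: dvd_iff_mod_p p_dvd_mult P_dvd) simp
    then show "Y \<in> Orb_set i y"
      using vtype_invariant[OF ab(1,2) k D w] iy Yc by (simp add: Orb_set_def cY)
  qed
  show "Orb_set i y \<subseteq> orbit (aut_units G F) (H2_act G F) X"
  proof
    fix Y assume Y: "Y \<in> Orb_set i y"
    obtain a1' a2' b' where cY: "H2_coords Y = (a1', a2', b')" by (metis prod_cases3)
    have Yc: "Y \<in> carrier (H2 G F)" and iy': "vtype a1' a2' = i" "(b' = 0) = y"
      using Y cY by (auto simp: Orb_set_def)
    have ab': "a1' \<in> P" "a2' \<in> P" "b' \<in> P" using bij_betwE[OF H2_coords_bij] Yc cY by auto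
    have inv: "\<exists>d. [x * d = x'] (mod int p) \<and> \<not> int p dvd d"
      if "x \<in> P" "x' \<in> P" "x = 0 \<longleftrightarrow> x' = 0" for x x'
    proof (cases "x = 0")
      case True
      then show ?thesis using that p_gt1 by (intro exI[of _ 1]) auto
    next
      case False
      then have nd: "\<not> int p dvd x" "\<not> int p dvd x'" using that by (simp_all add: P_dvd)
      then have "coprime x (int p)" by (simp add: coprime_p)
      then obtain j where j: "[x * j = 1] (mod int p)" using cong_solve_coprime_int by blast
      then have "[x * j * x' = 1 * x'] (mod int p)" by (intro cong_mult cong_refl)
      then have *: "[x * (j * x') = x'] (mod int p)" by (simp add: mult.assoc)
      then have "\<not> int p dvd j * x'"
        using nd(2) by (metis cong_dvd_iff dvd_mult)
      with * show ?thesis by blast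
    qed
    \<comment> \<open>The required determinant: \<open>b' / b\<close> modulo \<open>p\<close>, or
      just some unit if both are zero.\<close>
    obtain d where d: "[b * d = b'] (mod int p)" "\<not> int p dvd d"
      using inv[of b b'] ab ab' iy iy' by blast
    have "\<exists>u v w z. [a1 * u + a2 * v = a1'] (mod int p) \<and> [a1 * (q * w) + a2 * z = a2'] (mod int p)
      \<and> [u * z - v * (q * w) = d] (mod int p)"
    proof (cases "m1 < m2")
      case False
      then have q1: "q = 1" unfolding q_def by simp
      show ?thesis
      proof (cases "a1 = 0 \<and> a2 = 0")
        case True
        then have "a1' = 0 \<and> a2' = 0" using iy iy' by (auto simp: vtype_def split: if_splits)
        \<comment> \<open>Any matrix of determinant \<open>d\<close> fixes the zero vector; the
          diagonal one with entries \<open>d\<close> and \<open>1\<close> is taken.\<close>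
        with True show ?thesis
          by (intro exI[of _ d] exI[of _ 0] exI[of _ 0] exI[of _ 1]) simp
      next
        case False
        then have "\<not> (a1' = 0 \<and> a2' = 0)" using iy iy' by (auto simp: vtype_def split: if_splits)
        with False show ?thesis
          unfolding q1 using exists_matrix_cong[OF prime_int_p, of a1 a2 a1' a2' d] ab ab'
          by (simp add: P_dvd)
      qed
    next
      case True
      have z: "a2 = 0 \<longleftrightarrow> a2' = 0" using iy iy' True by (auto simp: vtype_def split: if_splits)
      show ?thesis
      proof (cases "a2 = 0")
        case True
        with z \<open>m1 < m2\<close> have "a2' = 0" "a1 = 0 \<longleftrightarrow> a1' = 0"
          using iy iy' by (auto simp: vtype_def split: if_splits)
        then obtain u where u: "[a1 * u = a1'] (mod int p)" "\<not> int p dvd u"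
          using inv[of a1 a1'] ab ab' by blast
        then have "coprime u (int p)" by (simp add: coprime_p)
        then obtain j where j: "[u * j = 1] (mod int p)" using cong_solve_coprime_int by blast
        then have "[u * j * d = 1 * d] (mod int p)" by (intro cong_mult cong_refl)
        \<comment> \<open>A diagonal matrix: \<open>u\<close> is dictated by \<open>a1\<close> and
          \<open>a1'\<close>, the other entry is \<open>d / u\<close>.\<close>
        then show ?thesis
          using True \<open>a2' = 0\<close> u
          by (intro exI[of _ u] exI[of _ 0] exI[of _ 0] exI[of _ "j * d"]) (simp add: mult.assoc)
      next
        case False
        then obtain z where z: "[a2 * z = a2'] (mod int p)" "\<not> int p dvd z"
          using inv[of a2 a2'] z ab ab' by blast
        then have "coprime z (int p)" "coprime a2 (int p)"
          using False ab by (simp_all add: coprime_p P_dvd)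
        then obtain j l where j: "[z * j = 1] (mod int p)" and l: "[a2 * l = 1] (mod int p)"
          using cong_solve_coprime_int by metis
        \<comment> \<open>Triangular with \<open>w = 0\<close>: \<open>z = a2' / a2\<close>, then
          \<open>u = d / z\<close> from the determinant, and \<open>v = (a1' - a1 * u) / a2\<close>
          from the first equation.\<close>
        have "[z * j * d = 1 * d] (mod int p)" using j by (intro cong_mult cong_refl)
        then have 1: "[j * d * z = d] (mod int p)" by (simp add: mult_ac)
        have "[a2 * l * (a1' - a1 * (j * d)) = 1 * (a1' - a1 * (j * d))] (mod int p)"
          using l by (intro cong_mult cong_refl)
        then have "[a1 * (j * d) + a2 * l * (a1' - a1 * (j * d))
            = a1 * (j * d) + 1 * (a1' - a1 * (j * d))] (mod int p)"
          by (intro cong_add cong_refl)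
        then have 2: "[a1 * (j * d) + a2 * (l * (a1' - a1 * (j * d))) = a1'] (mod int p)"
          by (simp add: mult.assoc)
        show ?thesis
          using 1 2 z(1)
          by (intro exI[of _ "j * d"] exI[of _ "l * (a1' - a1 * (j * d))"] exI[of _ 0] exI[of _ z]) simp
      qed
    qed
    then obtain u v w z where M: "[a1 * u + a2 * v = a1'] (mod int p)"
      "[a1 * (q * w) + a2 * z = a2'] (mod int p)" "[u * z - q * v * w = d] (mod int p)"
      by (auto simp: mult_ac)
    have D: "\<not> int p dvd u * z - q * v * w" using M(3) d(2) by (simp add: cong_dvd_iff)
    have "[b * (u * z - q * v * w) = b * d] (mod int p)" using M(3) by (intro cong_mult cong_refl)
    then have "[b * (u * z - q * v * w) = b'] (mod int p)" using d(1) by (rule cong_trans)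
    with exists_act[OF D Xc cX] M obtain g where g: "g \<in> carrier (aut_units G F)"
      "H2_act G F g X \<in> carrier (H2 G F)" "H2_coords (H2_act G F g X) = H2_coords Y"
      using ab' by (auto simp: cong_def cY P_mod)
    then have "Y = H2_act G F g X"
      using Yc bij_betw_imp_inj_on[OF H2_coords_bij] by (auto dest: inj_onD)
    then show "Y \<in> orbit (aut_units G F) (H2_act G F) X" unfolding orbit_def using g(1) by blast
  qed
qed

section \<open>Counting\<close>

lemma card_P: "card P = p" "finite P" "0 \<in> P" "1 \<in> P"
  using p_gt1 by (simp_all add: P_def)

definition types :: "nat set" where "types = (if m1 < m2 then {0, 1, 2} else {0, 2})"

lemma H2_coords_exists:
  assumes "a1 \<in> P" "a2 \<in> P" "b \<in> P"
  shows "\<exists>X\<in>carrier (H2 G F). H2_coords X = (a1, a2, b)"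
  using assms by (intro bexI[OF _ std_in_H2[of a1 a2 b]]) (simp add: H2_coords_std P_mod)

lemma Orb_set_nonempty:
  assumes "i \<in> types"
  shows "Orb_set i y \<noteq> {}"
proof -
  have "\<exists>a1\<in>P. \<exists>a2\<in>P. vtype a1 a2 = i"
  proof -
    have "vtype 0 0 = 0" "vtype 0 1 = 2" "m1 < m2 \<Longrightarrow> vtype 1 0 = 1" by (simp_all add: vtype_def)
    then show ?thesis using assms card_P by (auto simp: types_def split: if_splits)
  qed
  then obtain a1 a2 where a: "a1 \<in> P" "a2 \<in> P" "vtype a1 a2 = i" by blast
  have "(if y then 0 else 1) \<in> P" using card_P by simp
  from H2_coords_exists[OF a(1,2) this] obtain X where
    "X \<in> carrier (H2 G F)" "H2_coords X = (a1, a2, if y then 0 else 1)" by blast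
  then have "X \<in> Orb_set i y" using a by (simp add: Orb_set_def)
  then show ?thesis by blast
qed

lemma Orb_set_eq_iff:
  assumes "i \<in> types"
  shows "Orb_set i y = Orb_set i' y' \<longleftrightarrow> i = i' \<and> y = y'"
proof
  assume eq: "Orb_set i y = Orb_set i' y'"
  obtain X where X: "X \<in> Orb_set i y" using Orb_set_nonempty[OF assms] by blast
  then have "X \<in> Orb_set i' y'" using eq by simp
  with X show "i = i' \<and> y = y'" by (auto simp: Orb_set_def)
qed simp

lemma orbits_eq:
  "orbits (aut_units G F) (carrier (H2 G F)) (H2_act G F) = (\<lambda>(i, y). Orb_set i y) ` (types \<times> UNIV)"
proof (intro Set.set_eqI iffI)
  fix \<Omega> assume "\<Omega> \<in> orbits (aut_units G F) (carrier (H2 G F)) (H2_act G F)"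
  then obtain X where X: "X \<in> carrier (H2 G F)" and \<Omega>: "\<Omega> = orbit (aut_units G F) (H2_act G F) X"
    unfolding orbits_def by blast
  obtain a1 a2 b where cX: "H2_coords X = (a1, a2, b)" by (metis prod_cases3)
  have "X \<in> Orb_set (vtype a1 a2) (b = 0)" using X cX by (simp add: Orb_set_def)
  then have "\<Omega> = Orb_set (vtype a1 a2) (b = 0)" unfolding \<Omega> by (rule orbit_eq)
  moreover have "vtype a1 a2 \<in> types" by (simp add: vtype_def types_def)
  ultimately show "\<Omega> \<in> (\<lambda>(i, y). Orb_set i y) ` (types \<times> UNIV)" by blast
next
  fix \<Omega> assume "\<Omega> \<in> (\<lambda>(i, y). Orb_set i y) ` (types \<times> UNIV)"
  then obtain i y where i: "i \<in> types" and \<Omega>: "\<Omega> = Orb_set i y" by auto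
  obtain X where X: "X \<in> Orb_set i y" using Orb_set_nonempty[OF i] by blast
  then have "X \<in> carrier (H2 G F)" by (simp add: Orb_set_def)
  then show "\<Omega> \<in> orbits (aut_units G F) (carrier (H2 G F)) (H2_act G F)"
    unfolding orbits_def \<Omega> orbit_eq[OF X, symmetric] by blast
qed

lemma Orb_set_subset_ab_iff:
  assumes "i \<in> types"
  shows "Orb_set i y \<subseteq> H2_ab G F \<longleftrightarrow> y"
proof -
  have "X \<in> H2_ab G F \<longleftrightarrow> y" if "X \<in> Orb_set i y" for X
    using that H2_ab_iff[of X] by (auto simp: Orb_set_def)
  then show ?thesis using Orb_set_nonempty[OF assms, of y] by blast
qed

text \<open>A nonzero element of the span of cup products has coordinates \<open>(0, 0, b)\<close>
  with \<open>b\<close> nonzero, so adding it keeps the type and changes only the last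
  coordinate.\<close>

lemma cup_translates_Orb_set: "cup_translates G F (Orb_set i True) = Orb_set i False"
proof (intro Set.set_eqI iffI)
  interpret H: comm_group "H2 G F" by (rule T.H2_comm_group)
  have inj: "inj_on H2_coords (carrier (H2 G F))" using H2_coords_bij by (rule bij_betw_imp_inj_on)
  fix Y
  {
    assume "Y \<in> cup_translates G F (Orb_set i True)"
    then obtain X W where Y: "Y = X \<otimes>\<^bsub>H2 G F\<^esub> W" and X: "X \<in> Orb_set i True"
      and W: "W \<in> H2_span G F (Im_cup G F)" "W \<noteq> \<one>\<^bsub>H2 G F\<^esub>"
      unfolding cup_translates_def by blast
    obtain a1 a2 where cX: "H2_coords X = (a1, a2, 0)" and i: "vtype a1 a2 = i" and Xc: "X \<in> carrier (H2 G F)"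
      using X by (auto simp: Orb_set_def)
    obtain b where cW: "H2_coords W = (0, 0, b)" and Wc: "W \<in> carrier (H2 G F)"
      using W(1) unfolding span_cup by blast
    have b: "b \<noteq> 0" using inj_onD[OF inj _ Wc H.one_closed] W(2) cW H2_coords_one by metis
    have "a1 \<in> P" "a2 \<in> P" "b \<in> P" using bij_betwE[OF H2_coords_bij] Xc cX Wc cW by auto
    then have "H2_coords Y = (a1, a2, b)" using H2_coords_mult[OF Xc Wc cX cW] by (simp add: Y P_mod)
    then show "Y \<in> Orb_set i False" using Xc Wc i b by (simp add: Orb_set_def Y)
  next
    assume Y: "Y \<in> Orb_set i False"
    obtain a1 a2 b where cY: "H2_coords Y = (a1, a2, b)" by (metis prod_cases3)
    have Yc: "Y \<in> carrier (H2 G F)" and i: "vtype a1 a2 = i" "b \<noteq> 0"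
      using Y cY by (auto simp: Orb_set_def)
    have ab: "a1 \<in> P" "a2 \<in> P" "b \<in> P" using bij_betwE[OF H2_coords_bij] Yc cY by auto
    obtain X where X: "X \<in> carrier (H2 G F)" "H2_coords X = (a1, a2, 0)" using H2_coords_exists ab card_P by metis
    obtain W where W: "W \<in> carrier (H2 G F)" "H2_coords W = (0, 0, b)" using H2_coords_exists ab card_P by metis
    have "H2_coords (X \<otimes>\<^bsub>H2 G F\<^esub> W) = H2_coords Y"
      using H2_coords_mult[OF X(1) W(1) X(2) W(2)] ab by (simp add: cY P_mod)
    then have "Y = X \<otimes>\<^bsub>H2 G F\<^esub> W" using inj_onD[OF inj _ _ Yc] X(1) W(1) H.m_closed by metis
    moreover have "X \<in> Orb_set i True" using X i by (simp add: Orb_set_def)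
    moreover have "W \<in> H2_span G F (Im_cup G F)" using W unfolding span_cup by blast
    moreover have "W \<noteq> \<one>\<^bsub>H2 G F\<^esub>" using W(2) H2_coords_one i by auto
    ultimately show "Y \<in> cup_translates G F (Orb_set i True)" unfolding cup_translates_def by blast
  }
qed

text \<open>The conditions on \<open>(a1, a2)\<close> and on \<open>b\<close> are independent, so
  the coordinate set is a product.\<close>

lemma card_Orb_set:
  "card (Orb_set i y) = card {(a1, a2) \<in> P \<times> P. vtype a1 a2 = i} * (if y then 1 else p - 1)"
proof -
  let ?A = "{(a1, a2) \<in> P \<times> P. vtype a1 a2 = i}" and ?B = "{b \<in> P. (b = 0) = y}"
  let ?V = "{v \<in> P \<times> P \<times> P. case v of (a1, a2, b) \<Rightarrow> vtype a1 a2 = i \<and> (b = 0) = y}"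
  have "bij_betw H2_coords (Orb_set i y) ?V"
  proof (rule bij_betw_subset[OF H2_coords_bij])
    show "Orb_set i y \<subseteq> carrier (H2 G F)" by (auto simp: Orb_set_def)
    have image_filter: "f ` {x \<in> A. Q (f x)} = {y \<in> f ` A. Q y}" for f :: "'a \<Rightarrow> 'b" and A Q by blast
    show "H2_coords ` Orb_set i y = ?V"
      unfolding Orb_set_def bij_betw_imp_surj_on[OF H2_coords_bij, symmetric] by (rule image_filter)
  qed
  then have "card (Orb_set i y) = card ?V" by (rule bij_betw_same_card)
  also have "bij_betw (\<lambda>((a1, a2), b). (a1, a2, b)) (?A \<times> ?B) ?V"
    by (rule bij_betwI[where g = "\<lambda>(a1, a2, b). ((a1, a2), b)"]) auto
  then have "card ?V = card (?A \<times> ?B)" by (rule bij_betw_same_card[symmetric])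
  also have "\<dots> = card ?A * card ?B" by (rule card_cartesian_product)
  also have "?B = (if y then {0} else P - {0})" using card_P by auto
  also have "card \<dots> = (if y then 1 else p - 1)" using card_P by auto
  finally show ?thesis .
qed

lemma card_vtype:
  "card {(a1, a2) \<in> P \<times> P. vtype a1 a2 = 0} = 1"
  "m1 < m2 \<Longrightarrow> card {(a1, a2) \<in> P \<times> P. vtype a1 a2 = 1} = p - 1"
  "m1 < m2 \<Longrightarrow> card {(a1, a2) \<in> P \<times> P. vtype a1 a2 = 2} = p\<^sup>2 - p"
  "\<not> m1 < m2 \<Longrightarrow> card {(a1, a2) \<in> P \<times> P. vtype a1 a2 = 2} = p\<^sup>2 - 1"
proof -
  have "{(a1, a2) \<in> P \<times> P. vtype a1 a2 = 0} = {(0, 0)}"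
    using card_P by (auto simp: vtype_def split: if_splits)
  then show "card {(a1, a2) \<in> P \<times> P. vtype a1 a2 = 0} = 1" by simp
  assume "m1 < m2"
  then have "{(a1, a2) \<in> P \<times> P. vtype a1 a2 = 1} = (P - {0}) \<times> {0}"
    and 2: "{(a1, a2) \<in> P \<times> P. vtype a1 a2 = 2} = P \<times> (P - {0})"
    using card_P by (auto simp: vtype_def split: if_splits)
  then show "card {(a1, a2) \<in> P \<times> P. vtype a1 a2 = 1} = p - 1"
    using card_P by (simp add: card_cartesian_product)
  show "card {(a1, a2) \<in> P \<times> P. vtype a1 a2 = 2} = p\<^sup>2 - p"
    using 2 card_P by (simp add: card_cartesian_product power2_eq_square diff_mult_distrib2)
next
  assume "\<not> m1 < m2"
  then have "{(a1, a2) \<in> P \<times> P. vtype a1 a2 = 2} = P \<times> P - {(0, 0)}"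
    by (auto simp: vtype_def split: if_splits)
  then show "card {(a1, a2) \<in> P \<times> P. vtype a1 a2 = 2} = p\<^sup>2 - 1"
    using card_P by (simp add: card_cartesian_product power2_eq_square)
qed

lemma card_Orb_sets:
  "card (Orb_set 0 True) = 1" "card (Orb_set 0 False) = p - 1"
  "m1 < m2 \<Longrightarrow> card (Orb_set 1 True) = p - 1" "m1 < m2 \<Longrightarrow> card (Orb_set 1 False) = (p - 1)\<^sup>2"
  "m1 < m2 \<Longrightarrow> card (Orb_set 2 True) = p\<^sup>2 - p"
  "m1 < m2 \<Longrightarrow> card (Orb_set 2 False) = (p - 1) * (p\<^sup>2 - p)"
  "\<not> m1 < m2 \<Longrightarrow> card (Orb_set 2 True) = p\<^sup>2 - 1"
  "\<not> m1 < m2 \<Longrightarrow> card (Orb_set 2 False) = (p - 1) * (p\<^sup>2 - 1)"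
  unfolding card_Orb_set by (simp_all only: card_vtype not_False_eq_True if_True if_False power2_eq_square mult_1 mult_1_right mult.commute)

text \<open>The flag \<open>b = 0\<close> separates abelian from nonabelian classes, and it is
  constant on each orbit.\<close>

lemma orbits_ab_eq:
  defines "Orb \<equiv> orbits (aut_units G F) (carrier (H2 G F)) (H2_act G F)"
  shows "{\<Omega> \<in> Orb. \<Omega> \<subseteq> H2_ab G F} = (\<lambda>i. Orb_set i True) ` types" (is "?ab = ?T")
    "Orb - {\<Omega> \<in> Orb. \<Omega> \<subseteq> H2_ab G F} = (\<lambda>i. Orb_set i False) ` types" (is "_ = ?N")
proof -
  have Orb: "Orb = ?T \<union> ?N" by (auto simp: Orb_def orbits_eq UNIV_bool)
  have "\<Omega> \<subseteq> H2_ab G F" if "\<Omega> \<in> ?T" for \<Omega>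
    using that Orb_set_subset_ab_iff by blast
  moreover have "\<not> \<Omega> \<subseteq> H2_ab G F" if "\<Omega> \<in> ?N" for \<Omega>
    using that Orb_set_subset_ab_iff by blast
  ultimately show "?ab = ?T" "Orb - ?ab = ?N" unfolding Orb by blast+
qed

lemma card_orbits: "card (orbits (aut_units G F) (carrier (H2 G F)) (H2_act G F)) = 2 * card types"
proof -
  have "inj_on (\<lambda>(i, y). Orb_set i y) (types \<times> UNIV)"
    by (auto simp: inj_on_def Orb_set_eq_iff)
  then show ?thesis
    unfolding orbits_eq by (simp add: card_image card_cartesian_product UNIV_bool)
qed

end

theorem mainTheorem2:
  fixes p m1 m2 :: nat
  assumes "prime p" "0 < m1" "m1 \<le> m2" "p = 2 \<Longrightarrow> m1 > 1"
  shows
    "let G = integer_mod_group (p ^ m1) \<times>\<times> integer_mod_group (p ^ m2);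
         F = residue_ring (int p);
         Orb = orbits (aut_units G F) (carrier (H2 G F)) (H2_act G F);
         Orb_ab = {\<Omega> \<in> Orb. \<Omega> \<subseteq> H2_ab G F};
         T = cup_translates G F
     in card Orb = (if m1 = m2 then 4 else 6) \<and>
        (m1 = m2 \<longrightarrow>
          (\<exists>\<Omega>1 \<Omega>2.
             distinct [\<Omega>1, \<Omega>2] \<and> Orb_ab = {\<Omega>1, \<Omega>2} \<and>
             card \<Omega>1 = 1 \<and> card \<Omega>2 = p\<^sup>2 - 1 \<and>
             distinct [T \<Omega>1, T \<Omega>2] \<and> Orb - Orb_ab = {T \<Omega>1, T \<Omega>2} \<and>
             card (T \<Omega>1) = p - 1 \<and> card (T \<Omega>2) = (p - 1) * (p\<^sup>2 - 1))) \<and>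
        (m1 < m2 \<longrightarrow>
          (\<exists>\<Omega>1 \<Omega>2 \<Omega>3.
             distinct [\<Omega>1, \<Omega>2, \<Omega>3] \<and> Orb_ab = {\<Omega>1, \<Omega>2, \<Omega>3} \<and>
             card \<Omega>1 = 1 \<and> card \<Omega>2 = p - 1 \<and> card \<Omega>3 = p\<^sup>2 - p \<and>
             distinct [T \<Omega>1, T \<Omega>2, T \<Omega>3] \<and> Orb - Orb_ab = {T \<Omega>1, T \<Omega>2, T \<Omega>3} \<and>
             card (T \<Omega>1) = p - 1 \<and> card (T \<Omega>2) = (p - 1)\<^sup>2 \<and>
             card (T \<Omega>3) = (p - 1) * (p\<^sup>2 - p)))"
proof -
  interpret C: two_cyclic p m1 m2 using assms by unfold_locales
  have card: "card (orbits (aut_units C.G C.F) (carrier (H2 C.G C.F)) (H2_act C.G C.F))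
      = (if m1 = m2 then 4 else 6)"
    unfolding C.card_orbits using assms(3) by (simp add: C.types_def)
  note ab = C.orbits_ab_eq(1) C.orbits_ab_eq(2)[unfolded C.orbits_ab_eq(1)]
  show ?thesis
    unfolding Let_def C.G_def[symmetric]
  proof (intro conjI impI)
    show "card (orbits (aut_units C.G C.F) (carrier (H2 C.G C.F)) (H2_act C.G C.F))
      = (if m1 = m2 then 4 else 6)" by (rule card)
  next
    assume m: "m1 = m2"
    then have nm: "\<not> m1 < m2" by simp
    from m have t: "C.types = {0, 2}" unfolding C.types_def by simp
    show "\<exists>\<Omega>1 \<Omega>2. distinct [\<Omega>1, \<Omega>2] \<and>
        {\<Omega> \<in> orbits (aut_units C.G C.F) (carrier (H2 C.G C.F)) (H2_act C.G C.F). \<Omega> \<subseteq> H2_ab C.G C.F} = {\<Omega>1, \<Omega>2} \<and>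
        card \<Omega>1 = 1 \<and> card \<Omega>2 = p\<^sup>2 - 1 \<and>
        distinct [cup_translates C.G C.F \<Omega>1, cup_translates C.G C.F \<Omega>2] \<and>
        orbits (aut_units C.G C.F) (carrier (H2 C.G C.F)) (H2_act C.G C.F) -
          {\<Omega> \<in> orbits (aut_units C.G C.F) (carrier (H2 C.G C.F)) (H2_act C.G C.F). \<Omega> \<subseteq> H2_ab C.G C.F}
          = {cup_translates C.G C.F \<Omega>1, cup_translates C.G C.F \<Omega>2} \<and>
        card (cup_translates C.G C.F \<Omega>1) = p - 1 \<and>
        card (cup_translates C.G C.F \<Omega>2) = (p - 1) * (p\<^sup>2 - 1)"
      unfolding ab unfolding t
      \<comment> \<open>The orbits of the zero vector and of all nonzero vectors.\<close>
      by (rule exI[of _ "C.Orb_set 0 True"], rule exI[of _ "C.Orb_set 2 True"])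
        (simp add: C.cup_translates_Orb_set C.Orb_set_eq_iff t C.card_Orb_sets nm del: One_nat_def)
  next
    assume m: "m1 < m2"
    then have t: "C.types = {0, 1, 2}" by (simp add: C.types_def)
    show "\<exists>\<Omega>1 \<Omega>2 \<Omega>3. distinct [\<Omega>1, \<Omega>2, \<Omega>3] \<and>
        {\<Omega> \<in> orbits (aut_units C.G C.F) (carrier (H2 C.G C.F)) (H2_act C.G C.F). \<Omega> \<subseteq> H2_ab C.G C.F} = {\<Omega>1, \<Omega>2, \<Omega>3} \<and>
        card \<Omega>1 = 1 \<and> card \<Omega>2 = p - 1 \<and> card \<Omega>3 = p\<^sup>2 - p \<and>
        distinct [cup_translates C.G C.F \<Omega>1, cup_translates C.G C.F \<Omega>2, cup_translates C.G C.F \<Omega>3] \<and>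
        orbits (aut_units C.G C.F) (carrier (H2 C.G C.F)) (H2_act C.G C.F) -
          {\<Omega> \<in> orbits (aut_units C.G C.F) (carrier (H2 C.G C.F)) (H2_act C.G C.F). \<Omega> \<subseteq> H2_ab C.G C.F}
          = {cup_translates C.G C.F \<Omega>1, cup_translates C.G C.F \<Omega>2, cup_translates C.G C.F \<Omega>3} \<and>
        card (cup_translates C.G C.F \<Omega>1) = p - 1 \<and>
        card (cup_translates C.G C.F \<Omega>2) = (p - 1)\<^sup>2 \<and>
        card (cup_translates C.G C.F \<Omega>3) = (p - 1) * (p\<^sup>2 - p)"
      unfolding ab unfolding t
      \<comment> \<open>In the listed order: zero, the nonzero vectors of the line
        \<open>a2 = 0\<close>, and the complement of that line.\<close>
      by (rule exI[of _ "C.Orb_set 0 True"], rule exI[of _ "C.Orb_set 1 True"], rule exI[of _ "C.Orb_set 2 True"])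
        (simp add: C.cup_translates_Orb_set C.Orb_set_eq_iff t C.card_Orb_sets m del: One_nat_def)
  qed
qed

end
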